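(* Assume: (i) $F$ is bounded from below, strictly convex and Fréchet differentiable on $Y$, and $\nabla F:Y\to Y$ is Lipschitz continuous on compact subsets of $Y$; (ii) for every $\alpha\ge 0$ the sublevel set $\{u\in\mathcal M : \mathcal G(u)\le\alpha\}$ is weak* compact; (iii) whenever $\{u_k\}_k\subset\operatorname{dom}(\mathcal G)$ and $u_k\rightharpoonup^* u$ for some $u\in\mathcal M$, then $Ku_k\to Ku$ strongly in $Y$. Then the FC-GCG algorithm (described in the context) either terminates after a finite number of steps with $\bar u=u_k$ a minimizer of $J$ over $\mathcal M$, or it generates an infinite sequence $\{u_k\}_k$ for which there is a constant $c>0$ such that $$ J(u_k)-\min_{u\in\mathcal M}J(u)\le \frac{c}{k+1}\quad\text{for all } k\in\mathbb N .$$ Moreover, in the latter case, $\{u_k\}_k$ admits at least one weak* accumulation point and each such point is a minimizer of $J$ over $\mathcal M$. If the minimizer $\bar u$ of $J$ is unique, then $u_k\rightharpoonup^*\bar u$ in $\mathcal M$ for the whole sequence.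
   Context: Setting: $\mathcal C$ is a separable real Banach space, $\mathcal M=\mathcal C^*$ its topological dual with the dual norm, $\langle p,u\rangle$ denotes the duality pairing of $p\in\mathcal C$, $u\in\mathcal M$. $Y$ is a real Hilbert space, $F:Y\to\mathbb R$ is convex, $K:\mathcal M\to Y$ is linear and weak*-to-weak continuous, hence has a continuous pre-adjoint $K_*:Y\to\mathcal C$ with $\langle K_*y,u\rangle=(Ku,y)_Y$. $\mathcal G:\mathcal M\to[0,\infty]$ is convex, weak* lower semicontinuous and positively one-homogeneous ($\mathcal G(\lambda u)=\lambda\mathcal G(u)$ for $\lambda\ge0$). $J(u)=F(Ku)+\mathcal G(u)$; $\operatorname{dom}(\mathcal G)=\{u:\mathcal G(u)<\infty\}$; $B=\{u\in\mathcal M:\mathcal G(u)\le1\}$; $\operatorname{Ext}(B)$ is the set of extremal points of $B$. FC-GCG algorithm. Initialize with a finite set $\mathcal A_0=\{u^0_i\}_{i=1}^{N_0}\subset\operatorname{Ext}(B)$ and $u_0=\sum_{i=1}^{N_0}\lambda^0_iu^0_i$, $\lambda^0_i>0$. For $k=0,1,2,\dots$, given the finite active set $\mathcal A_k=\{u^k_i\}_{i=1}^{N_k}\subset\operatorname{Ext}(B)$ and $u_k\in\operatorname{cone}(\mathcal A_k)$: (a) compute $p_k=-K_*\nabla F(Ku_k)$ and some $\widehat v_k\in\arg\max_{v\in\operatorname{Ext}(B)}\langle p_k,v\rangle$ (a maximizer exists); (b) if $k\ge1$ and $\langle p_k,\widehat v_k\rangle\le1$, terminate with output $u_k$; (c)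 set $\mathcal A_k^+=\mathcal A_k\cup\{\widehat v_k\}$, $N_k^+=N_k+1$, $u^k_{N_k^+}=\widehat v_k$ (if $\widehat v_k\in\mathcal A_k$ already, then $\mathcal A_k^+=\mathcal A_k$ and $N_k^+=N_k$); (d) choose any $\lambda^{k+1}\in\arg\min_{\lambda\in[0,\infty)^{N_k^+}}\big[F\big(\sum_{i}\lambda_iKu^k_i\big)+\sum_i\lambda_i\big]$ and set $u_{k+1}=\sum_{i=1}^{N_k^+}\lambda^{k+1}_iu^k_i$; (e) set $\mathcal A_{k+1}=\mathcal A_k^+\setminus\{u^k_i:\lambda^{k+1}_i=0\}$, $N_{k+1}=\#\mathcal A_{k+1}$. *)

theory Defs
  imports "HOL-Analysis.Analysis"
begin

text \<open>The dual of a real normed space \<open>'c\<close> is the type \<open>'c \<Rightarrow>\<^sub>L real\<close>; the pairing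
  \<open>\<langle>p, u\<rangle>\<close> is \<open>blinfun_apply u p\<close>. For real-valued operators the strong operator topology
  is the topology of pointwise convergence on \<open>'c\<close>, that is, the weak* topology.\<close>

abbreviation weak_star :: "('c::real_normed_vector \<Rightarrow>\<^sub>L real) topology" where
  "weak_star \<equiv> strong_operator_topology"

definition weak_topology :: "'y::real_normed_vector topology" where
  "weak_topology =
     pullback_topology UNIV (\<lambda>y (f :: 'y \<Rightarrow>\<^sub>L real). blinfun_apply f y) euclidean"

text \<open>If \<open>K\<close> is linear and weak*-to-weak continuous, the element chosen here exists
  (weak* continuous linear functionals are evaluations) and is unique (the dual separates
  points), so the choice operator introduces no arbitrariness.\<close>

definition preadjoint ::
    "(('c::real_normed_vector \<Rightarrow>\<^sub>L real) \<Rightarrow> 'y::real_inner) \<Rightarrow> 'y \<Rightarrow> 'c" where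
  "preadjoint K y = (SOME p. \<forall>u. blinfun_apply u p = inner (K u) y)"

definition grad :: "('y::real_inner \<Rightarrow> real) \<Rightarrow> 'y \<Rightarrow> 'y" where
  "grad F y = (THE D. GDERIV F y :> D)"

definition strictly_convex :: "('y::real_vector \<Rightarrow> real) \<Rightarrow> bool" where
  "strictly_convex F \<longleftrightarrow>
     (\<forall>x y t. x \<noteq> y \<and> 0 < t \<and> t < 1 \<longrightarrow>
        F ((1 - t) *\<^sub>R x + t *\<^sub>R y) < (1 - t) * F x + t * F y)"

definition convex_ennreal :: "('m::real_vector \<Rightarrow> ennreal) \<Rightarrow> bool" where
  "convex_ennreal G \<longleftrightarrow>
     (\<forall>u v t. 0 \<le> t \<and> t \<le> 1 \<longrightarrow>
        G ((1 - t) *\<^sub>R u + t *\<^sub>R v) \<le> ennreal (1 - t) * G u + ennreal t * G v)"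

text \<open>In \<open>ennreal\<close> one has \<open>0 * \<infinity> = 0\<close>, so this forces \<open>G 0 = 0\<close>.\<close>

definition pos_homogeneous :: "('m::real_vector \<Rightarrow> ennreal) \<Rightarrow> bool" where
  "pos_homogeneous G \<longleftrightarrow> (\<forall>u t. 0 \<le> t \<longrightarrow> G (t *\<^sub>R u) = ennreal t * G u)"

definition weak_star_lsc ::
    "(('c::real_normed_vector \<Rightarrow>\<^sub>L real) \<Rightarrow> ennreal) \<Rightarrow> bool" where
  "weak_star_lsc G \<longleftrightarrow>
     (\<forall>u a. a < G u \<longrightarrow> (\<exists>U. openin weak_star U \<and> u \<in> U \<and> (\<forall>v\<in>U. a < G v)))"

definition objective ::
    "('y \<Rightarrow> real) \<Rightarrow> ('m \<Rightarrow> 'y) \<Rightarrow> ('m \<Rightarrow> ennreal) \<Rightarrow> 'm \<Rightarrow> ereal" where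
  "objective F K G u = ereal (F (K u)) + enn2ereal (G u)"

definition minimizer :: "('m \<Rightarrow> ereal) \<Rightarrow> 'm \<Rightarrow> bool" where
  "minimizer J u \<longleftrightarrow> is_arg_min J (\<lambda>_. True) u"

definition Ext_ball :: "('m::real_vector \<Rightarrow> ennreal) \<Rightarrow> 'm set" where
  "Ext_ball G = {v. v extreme_point_of {u. G u \<le> 1}}"

definition dual_variable ::
    "('y::real_inner \<Rightarrow> real) \<Rightarrow> (('c::real_normed_vector \<Rightarrow>\<^sub>L real) \<Rightarrow> 'y) \<Rightarrow>
     ('c \<Rightarrow>\<^sub>L real) \<Rightarrow> 'c" where
  "dual_variable F K u = - preadjoint K (grad F (K u))"

text \<open>Active sets are plain sets, and a coefficient vector is a function on points of which
  only the values on the current active set matter. \<open>fcgcg_init G A u\<close> is the initialization,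
  \<open>fcgcg_oracle\<close> step (a), \<open>fcgcg_stop\<close> the test (b), and \<open>fcgcg_correct F K A v A' u'\<close>
  performs (c)--(e): from active set \<open>A\<close> and new point \<open>v\<close> it admits \<open>A'\<close>, \<open>u'\<close> as next active
  set and iterate.\<close>

definition fcgcg_init :: "('m::real_vector \<Rightarrow> ennreal) \<Rightarrow> 'm set \<Rightarrow> 'm \<Rightarrow> bool" where
  "fcgcg_init G A u \<longleftrightarrow>
     finite A \<and> A \<subseteq> Ext_ball G \<and>
     (\<exists>l. (\<forall>w\<in>A. 0 < l w) \<and> u = (\<Sum>w\<in>A. l w *\<^sub>R w))"

definition fcgcg_oracle ::
    "('y::real_inner \<Rightarrow> real) \<Rightarrow> (('c::real_normed_vector \<Rightarrow>\<^sub>L real) \<Rightarrow> 'y) \<Rightarrow>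
     (('c \<Rightarrow>\<^sub>L real) \<Rightarrow> ennreal) \<Rightarrow> ('c \<Rightarrow>\<^sub>L real) \<Rightarrow> ('c \<Rightarrow>\<^sub>L real) \<Rightarrow> bool" where
  "fcgcg_oracle F K G u v \<longleftrightarrow>
     is_arg_max (\<lambda>w. blinfun_apply w (dual_variable F K u)) (\<lambda>w. w \<in> Ext_ball G) v"

definition fcgcg_stop ::
    "('y::real_inner \<Rightarrow> real) \<Rightarrow> (('c::real_normed_vector \<Rightarrow>\<^sub>L real) \<Rightarrow> 'y) \<Rightarrow>
     nat \<Rightarrow> ('c \<Rightarrow>\<^sub>L real) \<Rightarrow> ('c \<Rightarrow>\<^sub>L real) \<Rightarrow> bool" where
  "fcgcg_stop F K k u v \<longleftrightarrow> 1 \<le> k \<and> blinfun_apply v (dual_variable F K u) \<le> 1"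

definition fcgcg_correct ::
    "('y::real_vector \<Rightarrow> real) \<Rightarrow> ('m::real_vector \<Rightarrow> 'y) \<Rightarrow>
     'm set \<Rightarrow> 'm \<Rightarrow> 'm set \<Rightarrow> 'm \<Rightarrow> bool" where
  "fcgcg_correct F K A v A' u' \<longleftrightarrow>
     (\<exists>l. is_arg_min
            (\<lambda>l. F (\<Sum>w\<in>insert v A. l w *\<^sub>R K w) + (\<Sum>w\<in>insert v A. l w))
            (\<lambda>l. \<forall>w\<in>insert v A. 0 \<le> l w) l \<and>
          u' = (\<Sum>w\<in>insert v A. l w *\<^sub>R w) \<and>
          A' = insert v A - {w. l w = 0})"

text \<open>A run is constrained only up to its first stopping index, if there is one; the entries of
  the sequences beyond that index are irrelevant.\<close>

definition fcgcg_run ::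
    "('y::real_inner \<Rightarrow> real) \<Rightarrow> (('c::real_normed_vector \<Rightarrow>\<^sub>L real) \<Rightarrow> 'y) \<Rightarrow>
     (('c \<Rightarrow>\<^sub>L real) \<Rightarrow> ennreal) \<Rightarrow>
     (nat \<Rightarrow> ('c \<Rightarrow>\<^sub>L real) set) \<Rightarrow> (nat \<Rightarrow> 'c \<Rightarrow>\<^sub>L real) \<Rightarrow> (nat \<Rightarrow> 'c \<Rightarrow>\<^sub>L real) \<Rightarrow> bool" where
  "fcgcg_run F K G A u v \<longleftrightarrow>
     fcgcg_init G (A 0) (u 0) \<and>
     (\<forall>k. (\<forall>j<k. \<not> fcgcg_stop F K j (u j) (v j)) \<longrightarrow>
        fcgcg_oracle F K G (u k) (v k) \<and>
        (\<not> fcgcg_stop F K k (u k) (v k) \<longrightarrow>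
           fcgcg_correct F K (A k) (v k) (A (Suc k)) (u (Suc k))))"

definition fcgcg_terminates_at ::
    "('y::real_inner \<Rightarrow> real) \<Rightarrow> (('c::real_normed_vector \<Rightarrow>\<^sub>L real) \<Rightarrow> 'y) \<Rightarrow>
     (nat \<Rightarrow> 'c \<Rightarrow>\<^sub>L real) \<Rightarrow> (nat \<Rightarrow> 'c \<Rightarrow>\<^sub>L real) \<Rightarrow> nat \<Rightarrow> bool" where
  "fcgcg_terminates_at F K u v n \<longleftrightarrow>
     (\<forall>j<n. \<not> fcgcg_stop F K j (u j) (v j)) \<and> fcgcg_stop F K n (u n) (v n)"

text \<open>Sequential accumulation points. For sequences in a weak* compact set these are the same
  as the topological cluster points, since \<open>'c\<close> will be separable.\<close>

definition weak_star_accumulation ::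
    "(nat \<Rightarrow> 'c::real_normed_vector \<Rightarrow>\<^sub>L real) \<Rightarrow> ('c \<Rightarrow>\<^sub>L real) \<Rightarrow> bool" where
  "weak_star_accumulation u w \<longleftrightarrow>
     (\<exists>r :: nat \<Rightarrow> nat. strict_mono r \<and> limitin weak_star (u \<circ> r) w sequentially)"

end

theory Submission
  imports Defs
begin

text \<open>Let \<open>m\<^sub>k\<close> be the value of the dual variable at the oracle point. Optimality under rescaling of
  the coefficients gives \<open>\<langle>p\<^sub>k, u\<^sub>k\<rangle> = \<Sum>\<^sub>i \<lambda>\<^sub>i\<close>, so convexity of \<open>F\<close> and homogeneity of \<open>G\<close> yield
  \<open>J w \<ge> h\<^sub>k - (m\<^sub>k - 1) G w\<close> for all \<open>w\<close>, where \<open>h\<^sub>k = F (K u\<^sub>k) + \<Sum>\<^sub>i \<lambda>\<^sub>i \<ge> J u\<^sub>k\<close>. If \<open>m\<^sub>k \<le> 1\<close>, then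
  \<open>u\<^sub>k\<close> is a minimizer. Otherwise \<open>h\<^sub>k - min J \<le> M (m\<^sub>k - 1)\<close> for a bound \<open>M\<close> of \<open>G\<close> on a sublevel set of
  \<open>J\<close>, and comparing with the points \<open>(1 - t) u\<^sub>k + t M v\<^sub>k\<close>, whose images under \<open>K\<close> stay in a compact
  set on which the gradient is Lipschitz, shows that \<open>r\<^sub>k = h\<^sub>k - min J\<close> satisfies
  \<open>r\<^sub>k\<^sub>+\<^sub>1 \<le> r\<^sub>k - t r\<^sub>k + C t\<^sup>2\<close> for \<open>0 \<le> t \<le> 1\<close>; this forces \<open>r\<^sub>k = O(1/k)\<close>. Accumulation points
  are minimizers by lower semicontinuity.\<close>

section \<open>Weak* compact sets in the dual of a separable space\<close>

lemma separable_dense_sequence: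
  assumes "separable_space (euclidean :: 'a::topological_space topology)"
  obtains x :: "nat \<Rightarrow> 'a::topological_space" where "closure (range x) = UNIV"
proof -
  obtain U :: "'a set" where U: "countable U" "closure U = UNIV"
    using assms unfolding separable_space_def by auto
  then have "U \<noteq> {}" by auto
  with U have "closure (range (from_nat_into U)) = UNIV"
    by (simp add: range_from_nat_into)
  then show thesis by (rule that)
qed

lemma blinfun_eq_if_eq_on_dense:
  fixes u v :: "'c::real_normed_vector \<Rightarrow>\<^sub>L real"
  assumes "closure (range x) = UNIV" "\<And>n. blinfun_apply u (x n) = blinfun_apply v (x n)"
  shows "u = v"
proof (rule blinfun_eqI)
  fix y
  have "closed {y. blinfun_apply u y = blinfun_apply v y}"
    by (intro closed_Collect_eq continuous_intros)
  moreover have "range x \<subseteq> {y. blinfun_apply u y = blinfun_apply v y}" using assms(2) by auto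
  ultimately have "closure (range x) \<subseteq> {y. blinfun_apply u y = blinfun_apply v y}"
    by (rule closure_minimal[rotated])
  then show "blinfun_apply u y = blinfun_apply v y" using assms(1) by auto
qed

lemma continuous_map_weak_star_eval_sequence:
  "continuous_map weak_star euclidean (\<lambda>(u :: 'c::real_normed_vector \<Rightarrow>\<^sub>L real) (n::nat). blinfun_apply u (x n))"
proof -
  have "continuous_map weak_star (product_topology (\<lambda>_. euclidean) UNIV)
      (\<lambda>(u :: 'c \<Rightarrow>\<^sub>L real) n. blinfun_apply u (x n))"
    unfolding continuous_map_componentwise_UNIV
    by (simp add: strong_operator_topology_continuous_evaluation)
  then show ?thesis by (simp add: euclidean_product_topology)
qed

lemma inj_eval_dense_sequence:
  assumes "closure (range x) = UNIV"
  shows "inj_on (\<lambda>(u :: 'c::real_normed_vector \<Rightarrow>\<^sub>L real) (n::nat). blinfun_apply u (x n)) S"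
  by (rule inj_onI, rule blinfun_eq_if_eq_on_dense[OF assms], metis)

text \<open>Evaluation along a dense sequence embeds a weak* compact set homeomorphically into the
  metrizable space of real sequences.\<close>

lemma weak_star_compact_imp_convergent_subsequence:
  fixes S :: "('c::real_normed_vector \<Rightarrow>\<^sub>L real) set" and s :: "nat \<Rightarrow> 'c \<Rightarrow>\<^sub>L real"
  assumes sep: "separable_space (euclidean :: 'c topology)"
    and S: "compactin weak_star S" and s: "\<And>n. s n \<in> S"
  obtains w r where "w \<in> S" "strict_mono r" "limitin weak_star (s \<circ> r) w sequentially"
proof -
  obtain x :: "nat \<Rightarrow> 'c" where x: "closure (range x) = UNIV"
    by (rule separable_dense_sequence[OF sep])
  define \<phi> where "\<phi> = (\<lambda>(u :: 'c \<Rightarrow>\<^sub>L real) (n::nat). blinfun_apply u (x n))"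
  have inj: "inj_on \<phi> S" unfolding \<phi>_def by (rule inj_eval_dense_sequence[OF x])
  have cont: "continuous_map weak_star euclidean \<phi>"
    unfolding \<phi>_def by (rule continuous_map_weak_star_eval_sequence)
  \<comment> \<open>A continuous injection of a compact space into a Hausdorff space is a
    homeomorphism onto its image; its inverse carries convergence of real sequences back to weak*
    convergence.\<close>
  have homeo: "homeomorphic_map (subtopology weak_star S) (top_of_set (\<phi> ` S)) \<phi>"
  proof (rule continuous_imp_homeomorphic_map)
    show "compact_space (subtopology weak_star S)"
      using S by (simp add: compactin_subspace)
    show "Hausdorff_space (top_of_set (\<phi> ` S))"
      by (simp add: Hausdorff_space_subtopology)
    show "continuous_map (subtopology weak_star S) (top_of_set (\<phi> ` S)) \<phi>"
      using cont by (auto simp: continuous_map_in_subtopology continuous_map_from_subtopology)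
  qed (use inj in \<open>auto simp: strong_operator_topology_topspace\<close>)
  have "compactin euclidean (\<phi> ` S)" by (rule image_compactin[OF S cont])
  then have sc: "seq_compact (\<phi> ` S)" by (simp add: compact_imp_seq_compact)
  have "\<forall>n. (\<phi> \<circ> s) n \<in> \<phi> ` S" using s by simp
  with sc obtain l r where l: "l \<in> \<phi> ` S" and r: "strict_mono r"
    and lim: "((\<phi> \<circ> s) \<circ> r) \<longlonglongrightarrow> l"
    by (rule seq_compactE)
  obtain g where g: "homeomorphic_maps (subtopology weak_star S) (top_of_set (\<phi> ` S)) \<phi> g"
    using homeo homeomorphic_map_maps by blast
  then have gc: "continuous_map (top_of_set (\<phi> ` S)) (subtopology weak_star S) g"
    and g\<phi>: "\<And>u. u \<in> S \<Longrightarrow> g (\<phi> u) = u"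
    by (auto simp: homeomorphic_maps_def strong_operator_topology_topspace)
  obtain w where w: "w \<in> S" "l = \<phi> w" using l by auto
  have "limitin (top_of_set (\<phi> ` S)) ((\<phi> \<circ> s) \<circ> r) l sequentially"
    using lim l s by (auto simp: limitin_subtopology)
  then have "limitin (subtopology weak_star S) (g \<circ> ((\<phi> \<circ> s) \<circ> r)) (g l) sequentially"
    by (rule continuous_map_limit[OF gc])
  moreover have "g \<circ> ((\<phi> \<circ> s) \<circ> r) = s \<circ> r" using g\<phi> s by auto
  ultimately have "limitin weak_star (s \<circ> r) w sequentially"
    using w g\<phi> by (simp add: limitin_subtopology)
  then show thesis using w r that by blast
qed

text \<open>Faces cut out by maximizing an evaluation inherit compactness and nonemptiness, so the
  maximization can be iterated.\<close>

lemma weak_star_compact_argmax: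
  fixes S :: "('c::real_normed_vector \<Rightarrow>\<^sub>L real) set" and y :: 'c
  assumes S: "compactin weak_star S" and ne: "S \<noteq> {}"
  defines "T \<equiv> {u \<in> S. \<forall>w\<in>S. blinfun_apply w y \<le> blinfun_apply u y}"
  shows "compactin weak_star T" "T \<noteq> {}"
proof -
  have "compactin euclidean ((\<lambda>u. blinfun_apply u y) ` S)"
    by (rule image_compactin[OF S strong_operator_topology_continuous_evaluation])
  then obtain e where e: "e \<in> S" "\<And>w. w \<in> S \<Longrightarrow> blinfun_apply w y \<le> blinfun_apply e y"
    using compact_attains_sup[of "(\<lambda>u. blinfun_apply u y) ` S"] ne by auto
  then show "T \<noteq> {}" unfolding T_def by auto
  have "closedin weak_star {u \<in> topspace weak_star. blinfun_apply u y \<in> {blinfun_apply e y..}}"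
    by (rule closedin_continuous_map_preimage[OF strong_operator_topology_continuous_evaluation])
       auto
  then have "compactin weak_star
      (S \<inter> {u \<in> topspace weak_star. blinfun_apply u y \<in> {blinfun_apply e y..}})"
    using S by (simp add: compact_Int_closedin)
  also have "S \<inter> {u \<in> topspace weak_star. blinfun_apply u y \<in> {blinfun_apply e y..}} = T"
    unfolding T_def using e by (force simp: strong_operator_topology_topspace)
  finally show "compactin weak_star T" .
qed

text \<open>A maximizing extreme point is found by successively maximizing the evaluations along a
  dense sequence: the intersection of the resulting nested faces is a single point.\<close>

lemma weak_star_compact_extreme_maximizer:
  fixes S :: "('c::real_normed_vector \<Rightarrow>\<^sub>L real) set"
  assumes sep: "separable_space (euclidean :: 'c topology)"
    and S: "compactin weak_star S" and ne: "S \<noteq> {}"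
  obtains e where "e extreme_point_of S" "\<And>u. u \<in> S \<Longrightarrow> blinfun_apply u p \<le> blinfun_apply e p"
proof -
  obtain x :: "nat \<Rightarrow> 'c" where x: "closure (range x) = UNIV"
    by (rule separable_dense_sequence[OF sep])
  define am where "am y T = {u \<in> T. \<forall>w\<in>T. blinfun_apply w y \<le> blinfun_apply u y}"
    for y and T :: "('c \<Rightarrow>\<^sub>L real) set"
  define T where "T = rec_nat (am p S) (\<lambda>n. am (x n))"
  have T0: "T 0 = am p S" and TSuc: "\<And>n. T (Suc n) = am (x n) (T n)" by (simp_all add: T_def)
  have T: "compactin weak_star (T n) \<and> T n \<noteq> {}" for n
  proof (induction n)
    case 0 then show ?case using weak_star_compact_argmax[OF S ne] by (simp add: T0 am_def)
  next
    case (Suc n) then show ?case using weak_star_compact_argmax[of "T n"] by (simp add: TSuc am_def)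
  qed
  have anti: "T n \<subseteq> T m" if "m \<le> n" for m n
    using that by (induction rule: dec_induct) (auto simp: TSuc am_def)
  have TS: "T n \<subseteq> S" for n using anti[of 0 n] by (auto simp: T0 am_def)
  define \<phi> where "\<phi> = (\<lambda>(u :: 'c \<Rightarrow>\<^sub>L real) (n::nat). blinfun_apply u (x n))"
  have inj: "inj_on \<phi> UNIV" unfolding \<phi>_def by (rule inj_eval_dense_sequence[OF x])
  have cpt: "compactin euclidean (\<phi> ` T n)" for n
    using T[of n] continuous_map_weak_star_eval_sequence[of x]
    unfolding \<phi>_def by (blast intro: image_compactin)
  \<comment> \<open>Cantor's intersection argument runs on the images, where compact sets are
    closed. Injectivity of \<open>\<phi>\<close> then yields one preimage common to all
    faces.\<close>
  have "(\<Inter>n. \<phi> ` T n) \<noteq> {}"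
  proof (rule compact_space_imp_nest)
    show "compact_space (top_of_set (\<phi> ` T 0))"
      using cpt[of 0] by (simp add: compact_space_subtopology)
    show "closedin (top_of_set (\<phi> ` T 0)) (\<phi> ` T n)" for n
      using cpt[of n] anti[of 0 n] by (intro closed_subset compact_imp_closed) auto
    show "decseq (\<lambda>n. \<phi> ` T n)" using anti by (auto simp: decseq_def intro: image_mono)
  qed (use T in auto)
  then obtain z where "\<And>n. z \<in> \<phi> ` T n" by auto
  then obtain e where e: "\<And>n. e \<in> T n" using inj by (metis imageE inj_onD UNIV_I)
  \<comment> \<open>The face property: two nonnegative deficits with positive weights sum to zero,
    so both end points attain the maximum as well.\<close>
  have split: "a \<in> am y Q \<and> b \<in> am y Q \<and> blinfun_apply a y = blinfun_apply e y"
    if "a \<in> Q" "b \<in> Q" "e \<in> am y Q" "0 < t" "t < 1" "e = (1 - t) *\<^sub>R a + t *\<^sub>R b"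
    for a b y Q t
  proof -
    have le: "blinfun_apply a y \<le> blinfun_apply e y" "blinfun_apply b y \<le> blinfun_apply e y"
      using that(1-3) by (auto simp: am_def)
    have ev: "blinfun_apply e y = (1 - t) * blinfun_apply a y + t * blinfun_apply b y"
      using that(6) by (simp add: blinfun.bilinear_simps)
    have s: "(1 - t) * (blinfun_apply e y - blinfun_apply a y)
        + t * (blinfun_apply e y - blinfun_apply b y) = 0"
      using ev by (simp add: algebra_simps)
    have "0 \<le> (1 - t) * (blinfun_apply e y - blinfun_apply a y)"
      "0 \<le> t * (blinfun_apply e y - blinfun_apply b y)" using le that(4,5) by auto
    then have "(1 - t) * (blinfun_apply e y - blinfun_apply a y) = 0"
      "t * (blinfun_apply e y - blinfun_apply b y) = 0" using s by linarith+
    then have "blinfun_apply a y = blinfun_apply e y" "blinfun_apply b y = blinfun_apply e y"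
      using that(4,5) by auto
    then show ?thesis using that(1-3) by (auto simp: am_def)
  qed
  have "e extreme_point_of S"
    unfolding extreme_point_of_def
  proof (intro conjI ballI notI)
    show "e \<in> S" using e TS by blast
  next
    fix a b assume ab: "a \<in> S" "b \<in> S" "e \<in> open_segment a b"
    then obtain t where t: "0 < t" "t < 1" "e = (1 - t) *\<^sub>R a + t *\<^sub>R b" "a \<noteq> b"
      unfolding in_segment by auto
    \<comment> \<open>End points of an open segment through \<open>e\<close> never leave the nested
      faces; hence \<open>a\<close> agrees with \<open>e\<close> along the dense sequence.\<close>
    have abT: "a \<in> T n \<and> b \<in> T n" for n
    proof (induction n)
      case 0 then show ?case using split[OF ab(1,2) _ t(1-3)] e[of 0] by (simp add: T0)
    next
      case (Suc n) then show ?case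
        using split[of a "T n" b "x n", OF _ _ _ t(1-3)] e[of "Suc n"] by (simp add: TSuc)
    qed
    have "blinfun_apply a (x n) = blinfun_apply e (x n)" for n
      using split[of a "T n" b "x n", OF _ _ _ t(1-3)] e[of "Suc n"] abT[of n] by (simp add: TSuc)
    then have ae: "a = e" by (rule blinfun_eq_if_eq_on_dense[OF x])
    have "t *\<^sub>R (b - a) = ((1 - t) *\<^sub>R a + t *\<^sub>R b) - a" by (simp add: algebra_simps)
    also have "\<dots> = 0" unfolding t(3)[symmetric] using ae by simp
    finally show False using t by auto
  qed
  moreover have "blinfun_apply u p \<le> blinfun_apply e p" if "u \<in> S" for u
    using e[of 0] that by (auto simp: T0 am_def)
  ultimately show thesis by (rule that)
qed

section \<open>The pre-adjoint\<close>

text \<open>The induction restricts \<open>V\<close> to the kernel of one functional at a time,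
  which is why \<open>V\<close> is arbitrary. The missing coefficient is the defect of the smaller
  formula at a vector \<open>e\<close> with \<open>f i e = 1\<close>.\<close>

lemma linear_combination_if_zero_on_kernels:
  fixes \<phi> :: "'a::real_vector \<Rightarrow> real" and f :: "'i \<Rightarrow> 'a \<Rightarrow> real"
  assumes "finite I" "linear \<phi>" "\<And>i. linear (f i)" "subspace V"
    and "\<And>u. u \<in> V \<Longrightarrow> (\<And>i. i \<in> I \<Longrightarrow> f i u = 0) \<Longrightarrow> \<phi> u = 0"
  shows "\<exists>c. \<forall>u\<in>V. \<phi> u = (\<Sum>i\<in>I. c i * f i u)"
  using assms
proof (induction I arbitrary: V rule: finite_induct)
  case empty then show ?case by auto
next
  case (insert i I)
  let ?V = "V \<inter> {u. f i u = 0}"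
  have "subspace {u. f i u = 0}" using insert.prems(2)[of i] by (rule linear_subspace_kernel)
  then have "subspace ?V" using insert.prems(3) by (rule subspace_inter[rotated])
  then obtain c where c: "\<And>u. u \<in> ?V \<Longrightarrow> \<phi> u = (\<Sum>j\<in>I. c j * f j u)"
    using insert.IH[OF insert.prems(1,2), of ?V] insert.prems(4) by auto
  have upd: "(\<Sum>j\<in>I. (c(i := d)) j * f j u) = (\<Sum>j\<in>I. c j * f j u)" for d u
    using insert.hyps by (intro sum.cong) auto
  show ?case
  proof (cases "\<forall>u\<in>V. f i u = 0")
    case True
    then show ?thesis using c insert.hyps upd by (intro exI[of _ "c(i := 0)"]) auto
  next
    case False
    then obtain a where a: "a \<in> V" "f i a \<noteq> 0" by auto
    define e where "e = (1 / f i a) *\<^sub>R a"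
    have e: "e \<in> V" "f i e = 1"
      using a insert.prems(2,3) by (auto simp: e_def subspace_scale linear_cmul)
    define d where "d = \<phi> e - (\<Sum>j\<in>I. c j * f j e)"
    have "\<phi> u = (\<Sum>j\<in>insert i I. (c(i := d)) j * f j u)" if u: "u \<in> V" for u
    proof -
      let ?w = "u - f i u *\<^sub>R e"
      have "?w \<in> ?V" using u e insert.prems(2,3)
        by (auto simp: subspace_diff subspace_scale linear_diff linear_cmul)
      from c[OF this] have "\<phi> u - f i u * \<phi> e = (\<Sum>j\<in>I. c j * f j ?w)"
        using insert.prems(1) by (simp add: linear_diff linear_cmul)
      also have "\<dots> = (\<Sum>j\<in>I. c j * f j u) - f i u * (\<Sum>j\<in>I. c j * f j e)"
        using insert.prems(2)
        by (simp add: linear_diff linear_cmul sum_subtractf sum_distrib_left algebra_simps)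
      finally show ?thesis using insert.hyps upd by (simp add: d_def algebra_simps)
    qed
    then show ?thesis by blast
  qed
qed

text \<open>A basic weak* neighbourhood of 0 restricts only finitely many evaluations. A linear
  functional bounded on it vanishes on their common kernel, hence is a combination of them.\<close>

lemma weak_star_continuous_functional_is_evaluation:
  fixes \<phi> :: "('c::real_normed_vector \<Rightarrow>\<^sub>L real) \<Rightarrow> real"
  assumes lin: "linear \<phi>" and cont: "continuous_map weak_star euclidean \<phi>"
  shows "\<exists>p. \<forall>u. \<phi> u = blinfun_apply u p"
proof -
  have "openin weak_star {u \<in> topspace weak_star. \<phi> u \<in> {-1<..<1}}"
    by (rule openin_continuous_map_preimage[OF cont]) auto
  then have "openin weak_star {u. \<phi> u \<in> {-1<..<1}}" by (simp add: strong_operator_topology_topspace)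
  then obtain W :: "('c \<Rightarrow> real) set" where W: "open W" "{u. \<phi> u \<in> {-1<..<1}} = blinfun_apply -` W"
    unfolding strong_operator_topology_def openin_pullback_topology by auto
  have "(\<lambda>_. 0) \<in> W"
  proof -
    have "0 \<in> {u. \<phi> u \<in> {-1<..<1}}" using lin by (simp add: linear_0)
    then have "blinfun_apply 0 \<in> W" using W by auto
    then show ?thesis by (simp add: zero_blinfun.rep_eq)
  qed
  moreover have "openin (product_topology (\<lambda>_. euclidean) UNIV) W"
    using W(1) by (simp add: open_fun_def)
  ultimately obtain X where X: "(\<lambda>_. 0) \<in> (\<Pi>\<^sub>E i\<in>UNIV. X i)"
    "finite {i. X i \<noteq> UNIV}" "(\<Pi>\<^sub>E i\<in>UNIV. X i) \<subseteq> W"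
    using product_topology_open_contains_basis[of "\<lambda>_. euclidean" UNIV W "\<lambda>_. 0"] by auto
  have "\<phi> u = 0" if u: "\<And>i. i \<in> {i. X i \<noteq> UNIV} \<Longrightarrow> blinfun_apply u i = 0" for u
  proof (rule ccontr)
    assume nz: "\<phi> u \<noteq> 0"
    have "blinfun_apply (t *\<^sub>R u) \<in> (\<Pi>\<^sub>E i\<in>UNIV. X i)" for t
    proof (rule PiE_I)
      fix i show "blinfun_apply (t *\<^sub>R u) i \<in> X i"
        using u[of i] X(1) by (cases "X i = UNIV") (auto simp: blinfun.bilinear_simps)
    qed auto
    then have "blinfun_apply (t *\<^sub>R u) \<in> W" for t using X(3) by blast
    then have "\<phi> (t *\<^sub>R u) \<in> {-1<..<1}" for t using W(2) by blast
    \<comment> \<open>The whole line through \<open>u\<close> lies in the neighbourhood, yet this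
      multiple has the excluded value 1.\<close>
    from this[of "1 / \<phi> u"] show False using nz lin by (simp add: linear_cmul)
  qed
  then obtain c where c: "\<And>u. \<phi> u = (\<Sum>i | X i \<noteq> UNIV. c i * blinfun_apply u i)"
    using linear_combination_if_zero_on_kernels[OF X(2) lin, of "\<lambda>i u. blinfun_apply u i" UNIV]
    by (auto simp: linear_iff blinfun.bilinear_simps)
  have "\<phi> u = blinfun_apply u (\<Sum>i | X i \<noteq> UNIV. c i *\<^sub>R i)" for u
    by (simp add: c blinfun.bilinear_simps)
  then show ?thesis by blast
qed

text \<open>Testing \<open>K\<close> with the weakly continuous functional given by \<open>y\<close>
  produces a weak* continuous functional, hence an evaluation; so the choice in
  \<open>preadjoint\<close> has a witness.\<close>

lemma preadjoint_apply:
  fixes K :: "('c::real_normed_vector \<Rightarrow>\<^sub>L real) \<Rightarrow> 'y::real_inner"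
  assumes lin: "linear K" and cont: "continuous_map weak_star weak_topology K"
  shows "blinfun_apply u (preadjoint K y) = inner (K u) y"
proof -
  have "continuous_map euclidean euclidean (\<lambda>g :: ('y \<Rightarrow>\<^sub>L real) \<Rightarrow> real. g (blinfun_inner_left y))"
    by simp
  then have "continuous_map weak_topology euclidean
      ((\<lambda>g. g (blinfun_inner_left y)) \<circ> (\<lambda>y (f :: 'y \<Rightarrow>\<^sub>L real). blinfun_apply f y))"
    unfolding weak_topology_def by (rule continuous_map_pullback)
  from continuous_map_compose[OF cont this]
  have "continuous_map weak_star euclidean (\<lambda>u. inner (K u) y)"
    by (simp add: o_def inner_commute)
  moreover have "linear (\<lambda>u. inner (K u) y)"
    using lin by (simp add: linear_iff inner_add_left)
  ultimately have "\<exists>p. \<forall>u. inner (K u) y = blinfun_apply u p"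
    by (rule weak_star_continuous_functional_is_evaluation[rotated])
  then have "\<exists>p. \<forall>u. blinfun_apply u p = inner (K u) y" by metis
  then show ?thesis unfolding preadjoint_def by (rule someI2_ex) blast
qed

section \<open>Gradients of convex functions on a Hilbert space\<close>

text \<open>A maximizing sequence on the unit sphere is Cauchy, its limit \<open>x\<close> attains
  the operator norm \<open>a\<close>, and stationarity at \<open>x\<close> shows that
  \<open>a *\<^sub>R x\<close> represents \<open>f\<close>.\<close>

lemma riesz_representation:
  fixes f :: "'y::{real_inner, complete_space} \<Rightarrow> real"
  assumes "bounded_linear f"
  obtains D where "\<And>h. f h = inner h D"
proof (cases "\<forall>h. f h = 0")
  case True
  then show thesis using that[of 0] by simp
next
  case False
  interpret f: bounded_linear f by fact
  define a where "a = onorm f"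
  have apos: "a > 0" using False assms by (auto simp: a_def onorm_pos_lt)
  have bound: "\<bar>f h\<bar> \<le> a * norm h" for h using onorm[OF assms, of h] by (simp add: a_def)
  \<comment> \<open>Otherwise \<open>a - e\<close> would bound \<open>f\<close> on the unit sphere,
    and so would bound the operator norm.\<close>
  have "\<exists>x. norm x = 1 \<and> f x > a - e" if e: "0 < e" for e
  proof (rule ccontr)
    assume "\<nexists>x. norm x = 1 \<and> f x > a - e"
    then have le: "f x \<le> a - e" if "norm x = 1" for x using that by (meson not_less)
    have ev: "norm (f h) \<le> (a - e) * norm h" for h
    proof (cases "h = 0")
      case True then show ?thesis using f.zero by simp
    next
      case False
      then have n: "norm ((1 / norm h) *\<^sub>R h) = 1" "norm ((- 1 / norm h) *\<^sub>R h) = 1" by simp_all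
      have "f h / norm h \<le> a - e" "- f h / norm h \<le> a - e"
        using le[OF n(1)] le[OF n(2)] by (simp_all add: f.scaleR linear_neg[OF f.linear])
      then have "f h / norm h \<le> a - e" "(- f h) / norm h \<le> a - e" by simp_all
      moreover have "0 < norm h" using False by simp
      ultimately have "f h \<le> (a - e) * norm h" "- f h \<le> (a - e) * norm h"
        by (simp_all only: pos_divide_le_eq)
      then show ?thesis by (simp add: abs_le_iff)
    qed
    obtain h where "f h \<noteq> 0" using False by blast
    then have "0 < (a - e) * norm h" using ev[of h] by (smt (verit) zero_less_norm_iff)
    then have "0 \<le> a - e" by (simp add: zero_less_mult_iff)
    then have "onorm f \<le> a - e" using ev by (rule onorm_bound)
    then show False using e by (simp add: a_def)
  qed
  then have "\<forall>n. \<exists>x. norm x = 1 \<and> f x > a - a * inverse (real (Suc n))" using apos by simp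
  then obtain X where X: "\<And>n. norm (X n) = 1" "\<And>n. f (X n) > a - a * inverse (real (Suc n))"
    by metis
  \<comment> \<open>Nearly maximal unit vectors have a sum of norm almost 2; the parallelogram
    identity then makes their difference small.\<close>
  have sq: "(norm (X m - X n))\<^sup>2 \<le> 4 * (inverse (real (Suc m)) + inverse (real (Suc n)))" for m n
  proof -
    define d where "d = inverse (real (Suc m)) + inverse (real (Suc n))"
    have "a * (2 - d) < f (X m) + f (X n)" using X(2)[of m] X(2)[of n] by (simp add: d_def algebra_simps)
    also have "\<dots> \<le> a * norm (X m + X n)" using bound[of "X m + X n"] by (simp add: f.add)
    finally have ge: "2 - d \<le> norm (X m + X n)" using apos by simp
    have "(norm (X m + X n))\<^sup>2 + (norm (X m - X n))\<^sup>2 = 2 * (norm (X m))\<^sup>2 + 2 * (norm (X n))\<^sup>2"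
      by (simp add: power2_norm_eq_inner inner_add_left inner_add_right inner_diff_left inner_diff_right inner_commute)
    then have par: "(norm (X m - X n))\<^sup>2 = 4 - (norm (X m + X n))\<^sup>2" using X(1) by simp
    have "inverse (real (Suc m)) \<le> 1" "inverse (real (Suc n)) \<le> 1" by (simp_all add: inverse_le_1_iff)
    then have "d \<le> 2" by (simp add: d_def)
    then have "(2 - d)\<^sup>2 \<le> (norm (X m + X n))\<^sup>2" using ge by (intro power_mono) auto
    then have "(norm (X m - X n))\<^sup>2 \<le> 4 - (2 - d)\<^sup>2" using par by simp
    also have "\<dots> \<le> 4 * d" by (simp add: power2_eq_square algebra_simps)
    finally show ?thesis by (simp add: d_def)
  qed
  have "Cauchy X"
  proof (rule metric_CauchyI)
    fix e :: real assume e: "0 < e"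
    obtain N where N: "inverse (real (Suc N)) < e\<^sup>2 / 8"
      using reals_Archimedean[of "e\<^sup>2 / 8"] e by auto
    show "\<exists>M. \<forall>m\<ge>M. \<forall>n\<ge>M. dist (X m) (X n) < e"
    proof (intro exI allI impI)
      fix m n assume "N \<le> m" "N \<le> n"
      then have "inverse (real (Suc m)) \<le> inverse (real (Suc N))"
        "inverse (real (Suc n)) \<le> inverse (real (Suc N))" by (auto intro!: le_imp_inverse_le)
      then have "4 * (inverse (real (Suc m)) + inverse (real (Suc n)))
          \<le> 4 * (inverse (real (Suc N)) + inverse (real (Suc N)))"
        by (intro mult_left_mono add_mono) auto
      from order_trans[OF sq this] have "(norm (X m - X n))\<^sup>2 \<le> 8 * inverse (real (Suc N))"
        by simp
      also have "\<dots> < e\<^sup>2" using N by simp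
      finally show "dist (X m) (X n) < e"
        using e by (simp add: dist_norm power_less_imp_less_base)
    qed
  qed
  then obtain x where x: "X \<longlonglongrightarrow> x" using Cauchy_convergent convergent_def by blast
  have nx: "norm x = 1" using tendsto_norm[OF x] X(1) by (simp add: LIMSEQ_const_iff)
  have lim: "(\<lambda>n. a - a * inverse (real (Suc n))) \<longlonglongrightarrow> a - a * 0"
    by (intro tendsto_intros LIMSEQ_inverse_real_of_nat)
  have fx: "(\<lambda>n. f (X n)) \<longlonglongrightarrow> f x" by (rule f.tendsto[OF x])
  have "a - a * 0 \<le> f x"
    by (rule LIMSEQ_le[OF lim fx]) (use X(2) in \<open>auto intro: less_imp_le\<close>)
  then have fxa: "f x = a" using bound[of x] nx by simp
  have key: "f h = inner h (a *\<^sub>R x)" for h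
  proof -
    \<comment> \<open>the first variation of \<open>t \<mapsto> a\<^sup>2 \<parallel>x + t h\<parallel>\<^sup>2 - (f (x + t h))\<^sup>2 \<ge> 0\<close> vanishes at its zero \<open>t = 0\<close>\<close>
    define b where "b = a * (a * inner h x - f h)"
    define q where "q = a\<^sup>2 * (norm h)\<^sup>2 - (f h)\<^sup>2"
    have nn: "0 \<le> 2 * t * b + t\<^sup>2 * q" for t
    proof -
      have "(f (x + t *\<^sub>R h))\<^sup>2 \<le> (a * norm (x + t *\<^sub>R h))\<^sup>2"
        using bound[of "x + t *\<^sub>R h"] apos
        by (metis abs_ge_zero power2_abs power_mono)
      moreover have "(norm (x + t *\<^sub>R h))\<^sup>2 = 1 + 2 * t * inner h x + t\<^sup>2 * (norm h)\<^sup>2"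
      proof -
        have "inner x x = 1" using nx by (simp add: norm_eq_1)
        then show ?thesis
          unfolding power2_norm_eq_inner
          by (simp add: inner_add_left inner_add_right inner_commute power2_eq_square algebra_simps)
      qed
      moreover have "f (x + t *\<^sub>R h) = a + t * f h" by (simp add: f.add f.scaleR fxa)
      ultimately have "(a + t * f h)\<^sup>2 \<le> a\<^sup>2 * (1 + 2 * t * inner h x + t\<^sup>2 * (norm h)\<^sup>2)"
        by (simp add: power_mult_distrib)
      then show ?thesis by (simp add: b_def q_def power2_eq_square algebra_simps)
    qed
    have "b = 0"
    proof (rule ccontr)
      assume b: "b \<noteq> 0"
      \<comment> \<open>This scale keeps \<open>s * q\<close> below 1, so that at
        \<open>t = - s * b\<close> the linear term wins and the expression is negative.\<close>
      define s where "s = 1 / (1 + \<bar>q\<bar>)"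
      have s: "0 < s" "s * \<bar>q\<bar> < 1" by (auto simp: s_def field_simps)
      have "0 \<le> 2 * (- s * b) * b + (- s * b)\<^sup>2 * q" by (rule nn)
      also have "\<dots> = (s * b\<^sup>2) * (s * q - 2)" by (simp add: power2_eq_square algebra_simps)
      finally have "0 \<le> (s * b\<^sup>2) * (s * q - 2)" .
      moreover have "0 < s * b\<^sup>2" using s b by simp
      moreover have "s * q - 2 < 0" using s mult_left_mono[of q "\<bar>q\<bar>" s] by linarith
      ultimately show False using mult_pos_neg[of "s * b\<^sup>2" "s * q - 2"] by linarith
    qed
    then show ?thesis using apos by (simp add: b_def)
  qed
  then show thesis by (rule that)
qed

text \<open>Riesz representation supplies a gradient, and uniqueness of the Frechet derivative makes
  the definite description in \<open>grad\<close> pick it.\<close>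

lemma GDERIV_grad:
  fixes F :: "'y::{real_inner, complete_space} \<Rightarrow> real"
  assumes "F differentiable (at y)"
  shows "GDERIV F y :> grad F y"
proof -
  obtain F' where F': "(F has_derivative F') (at y)" using assms by (auto simp: differentiable_def)
  then obtain D where D: "\<And>h. F' h = inner h D"
    using riesz_representation has_derivative_bounded_linear by blast
  have "GDERIV F y :> D" unfolding gderiv_def using F' D by (metis (no_types, lifting) ext)
  moreover have "D' = D" if "GDERIV F y :> D'" for D'
  proof -
    have "(\<lambda>h. inner h D') = (\<lambda>h. inner h D)"
      using that \<open>GDERIV F y :> D\<close> unfolding gderiv_def by (rule has_derivative_unique)
    then have "inner (D' - D) D' = inner (D' - D) D" by metis
    then have "inner (D' - D) (D' - D) = 0" by (simp add: inner_diff_right)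
    then show ?thesis by simp
  qed
  ultimately show ?thesis unfolding grad_def by (rule theI)
qed

lemma DERIV_along_line:
  fixes F :: "'y::{real_inner, complete_space} \<Rightarrow> real"
  assumes "F differentiable (at y)"
  shows "((\<lambda>t. F (y + t *\<^sub>R h)) has_real_derivative inner h (grad F y)) (at 0)"
proof -
  have "(F has_derivative (\<lambda>h. inner h (grad F y))) (at (y + 0 *\<^sub>R h))"
    using GDERIV_grad[OF assms] by (simp add: gderiv_def)
  moreover have "((\<lambda>t. y + t *\<^sub>R h) has_derivative (\<lambda>t. t *\<^sub>R h)) (at 0)"
    by (auto intro!: derivative_eq_intros)
  ultimately have "((\<lambda>t. F (y + t *\<^sub>R h)) has_derivative (\<lambda>t. inner (t *\<^sub>R h) (grad F y))) (at 0)"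
    by (rule has_derivative_compose[rotated])
  moreover have "(\<lambda>t. inner (t *\<^sub>R h) (grad F y)) = (*) (inner h (grad F y))" by (auto simp: mult.commute)
  ultimately show ?thesis by (simp add: has_field_derivative_def)
qed

text \<open>By convexity the difference quotients at \<open>x\<close> towards \<open>y\<close> are
  at most \<open>F y - F x\<close>, a bound that survives the limit.\<close>

lemma convex_gradient_inequality:
  fixes F :: "'y::{real_inner, complete_space} \<Rightarrow> real"
  assumes conv: "convex_on UNIV F" and diff: "F differentiable (at x)"
  shows "F x + inner (y - x) (grad F x) \<le> F y"
proof -
  have "((\<lambda>t. (F (x + t *\<^sub>R (y - x)) - F x) / t) \<longlongrightarrow> inner (y - x) (grad F x)) (at_right 0)"
    using DERIV_along_line[OF diff, of "y - x"]
    by (auto simp: has_field_derivative_iff intro: tendsto_mono[OF at_le])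
  moreover have "\<forall>\<^sub>F t in at_right 0. (F (x + t *\<^sub>R (y - x)) - F x) / t \<le> F y - F x"
  proof -
    have "(F (x + t *\<^sub>R (y - x)) - F x) / t \<le> F y - F x" if t: "0 < t" "t < 1" for t
    proof -
      have "F ((1 - t) *\<^sub>R x + t *\<^sub>R y) \<le> (1 - t) * F x + t * F y"
        using conv t by (intro convex_onD) auto
      moreover have "(1 - t) *\<^sub>R x + t *\<^sub>R y = x + t *\<^sub>R (y - x)" by (simp add: algebra_simps)
      ultimately have "F (x + t *\<^sub>R (y - x)) - F x \<le> (F y - F x) * t" by (simp add: algebra_simps)
      then show ?thesis using t by (simp add: pos_divide_le_eq)
    qed
    then show ?thesis unfolding eventually_at_right_field by (intro exI[of _ 1]) auto
  qed
  ultimately have "inner (y - x) (grad F x) \<le> F y - F x"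
    by (intro tendsto_upperbound) auto
  then show ?thesis by simp
qed

text \<open>The gradient inequality at \<open>y\<close> replaces integration along the segment: only
  the end points must lie in \<open>S\<close>, at the price of \<open>L\<close> instead of
  \<open>L / 2\<close>.\<close>

lemma lipschitz_gradient_descent:
  fixes F :: "'y::{real_inner, complete_space} \<Rightarrow> real"
  assumes conv: "convex_on UNIV F" and diff: "\<And>y. F differentiable (at y)"
    and lip: "L-lipschitz_on S (grad F)" and "x \<in> S" "y \<in> S"
  shows "F y \<le> F x + inner (y - x) (grad F x) + L * (norm (y - x))\<^sup>2"
proof -
  have "F y + inner (x - y) (grad F y) \<le> F x"
    by (rule convex_gradient_inequality[OF conv diff])
  moreover have "inner (y - x) (grad F y - grad F x) \<le> norm (y - x) * (L * norm (y - x))"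
    using lipschitz_onD[OF lip \<open>y \<in> S\<close> \<open>x \<in> S\<close>]
    by (intro order_trans[OF norm_cauchy_schwarz] mult_left_mono) (auto simp: dist_norm)
  ultimately show ?thesis
    by (simp add: inner_diff_left inner_diff_right power2_eq_square algebra_simps)
qed

section \<open>Optimality and descent of the fully corrective step\<close>

text \<open>The best step length turns the hypothesis into the recursion
  \<open>x' \<le> x * (1 - x)\<close> for \<open>x = r k / (4 * C)\<close>. Indices start at 1
  because the initial iterate satisfies no optimality condition.\<close>

lemma descent_imp_harmonic_rate:
  fixes r :: "nat \<Rightarrow> real"
  assumes C: "0 < C" and nonneg: "\<And>k. 1 \<le> k \<Longrightarrow> 0 \<le> r k" and start: "r 1 \<le> 2 * C"
    and step: "\<And>k t. 1 \<le> k \<Longrightarrow> 0 \<le> t \<Longrightarrow> t \<le> 1 \<Longrightarrow> r (Suc k) \<le> r k - t * r k + C * t\<^sup>2"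
    and k: "1 \<le> k"
  shows "r k \<le> 4 * C / (real k + 1)"
  using k
proof (induction k rule: dec_induct)
  case base
  then show ?case using start by simp
next
  case (step k)
  define x where "x = r k / (4 * C)"
  define z where "z = 1 / (real k + 1)"
  have rk: "r k = 4 * C * x" using C by (simp add: x_def)
  have x: "0 \<le> x" "x \<le> z"
    using C nonneg[of k] step by (auto simp: x_def z_def field_simps)
  have z: "z \<le> 1 / 2" using step by (simp add: z_def field_simps)
  \<comment> \<open>The value \<open>2 * x = r k / (2 * C)\<close> minimizes the bound over
    \<open>t\<close>; it is admissible since \<open>x \<le> z \<le> 1 / 2\<close>.\<close>
  have "r (Suc k) \<le> r k - (2 * x) * r k + C * (2 * x)\<^sup>2"
    using assms(4)[of k "2 * x"] step x z by simp
  also have "\<dots> = 4 * C * (x * (1 - x))" by (simp add: rk power2_eq_square algebra_simps)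
  \<comment> \<open>The map \<open>x * (1 - x)\<close> is increasing up to 1/2.\<close>
  also have "\<dots> \<le> 4 * C * (z * (1 - z))"
  proof -
    have "0 \<le> (z - x) * (1 - z - x)" using x z by (intro mult_nonneg_nonneg) auto
    then have "x * (1 - x) \<le> z * (1 - z)" by (simp add: algebra_simps)
    then show ?thesis using C by simp
  qed
  also have "z * (1 - z) \<le> 1 / (real (Suc k) + 1)"
    by (simp add: z_def divide_simps) (simp add: algebra_simps)
  finally show ?case using C by simp
qed

section \<open>The setting, elementary properties of \<open>G\<close>, and solvability of steps (a)
  and (d)\<close>

locale fcgcg_setting =
  fixes F :: "'y::{real_inner, complete_space} \<Rightarrow> real"
    and K :: "('c::real_normed_vector \<Rightarrow>\<^sub>L real) \<Rightarrow> 'y"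
    and G :: "('c \<Rightarrow>\<^sub>L real) \<Rightarrow> ennreal"
  assumes separable: "separable_space (euclidean :: 'c topology)"
    and F_convex: "convex_on UNIV F"
    and K_linear: "linear K"
    and K_continuous: "continuous_map weak_star weak_topology K"
    and G_convex: "convex_ennreal G"
    and G_lsc: "weak_star_lsc G"
    and G_homogeneous: "pos_homogeneous G"
    and F_bounded_below: "bdd_below (range F)"
    and F_differentiable: "\<And>y. F differentiable (at y)"
    and grad_F_lipschitz: "\<And>S. compact S \<Longrightarrow> \<exists>L. L-lipschitz_on S (grad F)"
    and sublevel_compact: "\<And>\<alpha>::real. 0 \<le> \<alpha> \<Longrightarrow> compactin weak_star {u. G u \<le> ennreal \<alpha>}"
    and K_strong: "\<And>s w. (\<And>k::nat. G (s k) < \<infinity>) \<Longrightarrow> limitin weak_star s w sequentially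
                     \<Longrightarrow> (\<lambda>k. K (s k)) \<longlonglongrightarrow> K w"
begin

text \<open>Any \<open>s\<close> with \<open>F y + s \<le> F 0\<close> is at most
  \<open>gap\<close>. This one number bounds the weights of solutions of step (d) and the values of
  \<open>G\<close> where the objective is at most \<open>F 0\<close>.\<close>

definition gap :: real where "gap = F 0 - Inf (range F)"

lemma F_ge: "F 0 - gap \<le> F y"
  using F_bounded_below by (simp add: gap_def cInf_lower)

lemma gap_nonneg: "0 \<le> gap"
  using F_ge[of 0] by simp

lemma continuous_F: "continuous_on S F"
  by (intro continuous_at_imp_continuous_on ballI differentiable_imp_continuous_within F_differentiable)

lemma G_scaleR: "0 \<le> t \<Longrightarrow> G (t *\<^sub>R u) = ennreal t * G u"
  using G_homogeneous by (simp add: pos_homogeneous_def)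

lemma G_zero: "G 0 = 0"
  using G_scaleR[of 0 0] by simp

lemma G_finite: "G w \<le> ennreal a \<Longrightarrow> G w < \<infinity>"
  using le_less_trans[OF _ ennreal_less_top, of "G w" a] by simp

lemma G_convexD:
  "0 \<le> t \<Longrightarrow> t \<le> 1 \<Longrightarrow> G ((1 - t) *\<^sub>R u + t *\<^sub>R v) \<le> ennreal (1 - t) * G u + ennreal t * G v"
  using G_convex by (simp add: convex_ennreal_def)

text \<open>The sum is twice the midpoint, to which convexity applies.\<close>

lemma G_add: "G (u + v) \<le> G u + G v"
proof -
  have "G (u + v) = G (2 *\<^sub>R ((1 - 1/2) *\<^sub>R u + (1/2) *\<^sub>R v))" by (simp add: scaleR_add_right)
  also have "\<dots> = ennreal 2 * G ((1 - 1/2) *\<^sub>R u + (1/2) *\<^sub>R v)" by (rule G_scaleR) simp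
  also have "\<dots> \<le> ennreal 2 * (ennreal (1 - 1/2) * G u + ennreal (1/2) * G v)"
    by (intro mult_left_mono G_convexD) auto
  also have "\<dots> = ennreal (2 * (1 - 1/2)) * G u + ennreal (2 * (1/2)) * G v"
    by (simp only: distrib_left mult.assoc ennreal_mult'[of 2] zero_le_numeral)
  finally show ?thesis by simp
qed

text \<open>Step (d) controls the total weight, which may exceed \<open>G\<close>; this inequality
  transfers bounds from the weight to \<open>G\<close>.\<close>

lemma G_cone:
  assumes "finite A" "\<And>w. w \<in> A \<Longrightarrow> G w \<le> 1" "\<And>w. w \<in> A \<Longrightarrow> 0 \<le> l w"
  shows "G (\<Sum>w\<in>A. l w *\<^sub>R w) \<le> ennreal (\<Sum>w\<in>A. l w)"
  using assms
proof (induction A rule: finite_induct)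
  case empty
  then show ?case by (simp add: G_zero)
next
  case (insert a A)
  have "G (\<Sum>w\<in>insert a A. l w *\<^sub>R w) \<le> G (l a *\<^sub>R a) + G (\<Sum>w\<in>A. l w *\<^sub>R w)"
    using insert.hyps G_add by simp
  also have "\<dots> \<le> ennreal (l a) * 1 + ennreal (\<Sum>w\<in>A. l w)"
  proof (rule add_mono)
    show "G (l a *\<^sub>R a) \<le> ennreal (l a) * 1"
      using insert.prems by (simp only: G_scaleR insertI1) (intro mult_left_mono, auto)
  qed (use insert in auto)
  also have "\<dots> = ennreal (\<Sum>w\<in>insert a A. l w)"
    using insert by (simp add: ennreal_plus sum_nonneg)
  finally show ?case .
qed

lemma K_cone: "K (\<Sum>w\<in>A. l w *\<^sub>R w) = (\<Sum>w\<in>A. l w *\<^sub>R K w)"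
  using K_linear by (simp add: linear_sum linear_cmul)

lemma dual_pairing: "blinfun_apply w (dual_variable F K u) = - inner (K w) (grad F (K u))"
  by (simp add: dual_variable_def blinfun.minus_right preadjoint_apply[OF K_linear K_continuous])

lemma Ext_ball_le: "w \<in> Ext_ball G \<Longrightarrow> G w \<le> 1"
  by (auto simp: Ext_ball_def extreme_point_of_def)

lemma ball_extreme_maximizer:
  obtains e where "e \<in> Ext_ball G" "\<And>w. G w \<le> 1 \<Longrightarrow> blinfun_apply w p \<le> blinfun_apply e p"
proof -
  have "compactin weak_star {u. G u \<le> 1}" using sublevel_compact[of 1] by simp
  moreover have "{u. G u \<le> 1} \<noteq> {}" using G_zero by (auto intro!: exI[of _ 0])
  ultimately show thesis
    by (rule weak_star_compact_extreme_maximizer[OF separable, where p = p])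
      (auto simp: Ext_ball_def intro: that)
qed

lemma oracle_exists: "\<exists>z. fcgcg_oracle F K G w z"
proof -
  obtain e where "e \<in> Ext_ball G"
    "\<And>u. G u \<le> 1 \<Longrightarrow> blinfun_apply u (dual_variable F K w) \<le> blinfun_apply e (dual_variable F K w)"
    using ball_extreme_maximizer[where p = "dual_variable F K w"] by blast
  then show ?thesis
    unfolding fcgcg_oracle_def is_arg_max_def using Ext_ball_le by (meson not_less)
qed

lemma oracle_Ext: "fcgcg_oracle F K G u v \<Longrightarrow> v \<in> Ext_ball G"
  by (simp add: fcgcg_oracle_def is_arg_max_def)

text \<open>The oracle compares extreme points only, but some extreme point is maximal over the
  whole ball.\<close>

lemma oracle_ge_ball:
  assumes "fcgcg_oracle F K G u v" "G w \<le> 1"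
  shows "blinfun_apply w (dual_variable F K u) \<le> blinfun_apply v (dual_variable F K u)"
proof -
  obtain e where "e \<in> Ext_ball G"
    "\<And>w. G w \<le> 1 \<Longrightarrow> blinfun_apply w (dual_variable F K u) \<le> blinfun_apply e (dual_variable F K u)"
    using ball_extreme_maximizer[where p = "dual_variable F K u"] by blast
  moreover from this(1) have "blinfun_apply e (dual_variable F K u) \<le> blinfun_apply v (dual_variable F K u)"
    using assms(1) by (auto simp: fcgcg_oracle_def is_arg_max_def not_less)
  ultimately show ?thesis using assms(2) order_trans by blast
qed

lemma oracle_dual_bound:
  assumes v: "fcgcg_oracle F K G u v" and w: "G w \<le> ennreal g" and g: "0 \<le> g"
  shows "blinfun_apply w (dual_variable F K u) \<le> blinfun_apply v (dual_variable F K u) * g"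
proof -
  define m where "m = blinfun_apply v (dual_variable F K u)"
  have m: "0 \<le> m" using oracle_ge_ball[OF v, of 0] by (simp add: m_def G_zero)
  \<comment> \<open>The bound \<open>g\<close> may be 0, so \<open>w\<close> is normalized by
    \<open>g + e\<close> instead.\<close>
  have le: "blinfun_apply w (dual_variable F K u) \<le> m * (g + e)" if e: "0 < e" for e
  proof -
    have "G ((1 / (g + e)) *\<^sub>R w) = ennreal (1 / (g + e)) * G w"
      using e g by (intro G_scaleR) auto
    also have "\<dots> \<le> ennreal (1 / (g + e)) * ennreal g" using w by (rule mult_left_mono) simp
    also have "\<dots> = ennreal (g / (g + e))" using e g by (simp add: ennreal_mult'[symmetric])
    also have "\<dots> \<le> 1" using e g by simp
    finally have "blinfun_apply ((1 / (g + e)) *\<^sub>R w) (dual_variable F K u) \<le> m"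
      unfolding m_def by (rule oracle_ge_ball[OF v])
    then have "blinfun_apply w (dual_variable F K u) / (g + e) \<le> m"
      by (simp add: blinfun.bilinear_simps)
    then show ?thesis using e g by (simp add: pos_divide_le_eq)
  qed
  show ?thesis
    unfolding m_def[symmetric]
  proof (rule field_le_epsilon)
    fix e :: real assume e: "0 < e"
    \<comment> \<open>Division by \<open>m + 1\<close> rather than \<open>m\<close> covers
      \<open>m = 0\<close>.\<close>
    have "blinfun_apply w (dual_variable F K u) \<le> m * (g + e / (m + 1))"
      using e m by (intro le) auto
    also have "\<dots> \<le> m * g + e" using e m by (simp add: field_simps)
    finally show "blinfun_apply w (dual_variable F K u) \<le> m * g + e" .
  qed
qed

text \<open>A coefficient above \<open>gap\<close> is worse than all coefficients being zero, so
  minimization over a box suffices.\<close>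

lemma correct_exists:
  assumes "finite S"
  shows "\<exists>S' w. fcgcg_correct F K S z S' w"
proof -
  let ?T = "insert z S"
  define f where "f l = F (\<Sum>w\<in>?T. l w *\<^sub>R K w) + (\<Sum>w\<in>?T. l w)" for l
  \<comment> \<open>The box lives in the full function space, where it is compact by Tychonoff;
    \<open>f\<close> depends on finitely many coordinates only.\<close>
  define P :: "(('c \<Rightarrow>\<^sub>L real) \<Rightarrow> real) set" where "P = (\<Pi>\<^sub>E w\<in>UNIV. {0..gap})"
  have "compactin (product_topology (\<lambda>_. euclidean) UNIV) P"
    unfolding P_def by (subst compactin_PiE) auto
  then have "compact P" by (simp add: euclidean_product_topology)
  moreover have "P \<noteq> {}" using gap_nonneg by (auto simp: P_def)
  moreover have "continuous_on P f"
    unfolding f_def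
    by (intro continuous_intros continuous_on_compose2[OF continuous_F[of UNIV]]
        continuous_on_subset[OF continuous_on_product_coordinates]) auto
  ultimately obtain l where l: "l \<in> P" and min: "\<And>l'. l' \<in> P \<Longrightarrow> f l \<le> f l'"
    using continuous_attains_inf by metis
  have "is_arg_min f (\<lambda>l. \<forall>w\<in>?T. 0 \<le> l w) l"
    unfolding is_arg_min_def
  proof (intro conjI notI)
    show "\<forall>w\<in>?T. 0 \<le> l w" using l by (auto simp: P_def PiE_iff)
  next
    assume "\<exists>l'. (\<forall>w\<in>?T. 0 \<le> l' w) \<and> f l' < f l"
    then obtain l' where l': "\<And>w. w \<in> ?T \<Longrightarrow> 0 \<le> l' w" "f l' < f l" by auto
    show False
    proof (cases "\<forall>w\<in>?T. l' w \<le> gap")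
      case True
      \<comment> \<open>Values of \<open>l'\<close> off the active set are arbitrary; setting them
        to 0 places the competitor in the box without changing \<open>f\<close>.\<close>
      have "f l \<le> f (\<lambda>w. if w \<in> ?T then l' w else 0)"
        using True l' gap_nonneg by (intro min) (auto simp: P_def)
      also have "\<dots> = f l'" unfolding f_def by (intro arg_cong2[where f = "(+)"] arg_cong[where f = F] sum.cong) auto
      finally show False using l' by simp
    next
      case False
      then obtain a where a: "a \<in> ?T" "gap < l' a" by (auto simp: not_le)
      have "l' a \<le> sum l' ?T" using a l' assms by (intro member_le_sum) auto
      then have "F 0 \<le> f l'" using a F_ge[of "\<Sum>w\<in>?T. l' w *\<^sub>R K w"] by (simp only: f_def)
      also have "F 0 = f (\<lambda>_. 0)" by (simp add: f_def)
      moreover have "f l \<le> f (\<lambda>_. 0)" using gap_nonneg by (intro min) (auto simp: P_def)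
      ultimately show False using l' by simp
    qed
  qed
  then show ?thesis unfolding fcgcg_correct_def f_def by blast
qed

text \<open>Optimality with respect to rescaling all coefficients by a common factor replaces the full
  first-order conditions of step (d).\<close>

definition scaling_optimal :: "('c \<Rightarrow>\<^sub>L real) set \<Rightarrow> ('c \<Rightarrow>\<^sub>L real) \<Rightarrow> bool" where
  "scaling_optimal A u \<longleftrightarrow> finite A \<and> A \<subseteq> Ext_ball G \<and>
     (\<exists>l. (\<forall>w\<in>A. 0 \<le> l w) \<and> u = (\<Sum>w\<in>A. l w *\<^sub>R w) \<and>
       (\<forall>t\<ge>0. F (K u) + sum l A \<le> F (t *\<^sub>R K u) + t * sum l A))"

text \<open>At scaling optimal points the total weight is \<open>\<langle>p, u\<rangle>\<close>, so that this is the value of the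
  finite-dimensional problem in step (d), whatever the representation of \<open>u\<close>.\<close>

definition upper_value :: "('c \<Rightarrow>\<^sub>L real) \<Rightarrow> real" where
  "upper_value u = F (K u) - inner (K u) (grad F (K u))"

text \<open>The factor 1 is an interior minimum over all factors \<open>t \<ge> 0\<close>, so the
  derivative there vanishes; the radius 1 keeps \<open>1 + t\<close> nonnegative.\<close>

lemma weight_if_scaling_optimal:
  assumes opt: "\<And>t. 0 \<le> t \<Longrightarrow> F y + s \<le> F (t *\<^sub>R y) + t * s"
  shows "s = - inner y (grad F y)"
proof -
  have "((\<lambda>t. F (y + t *\<^sub>R y) + (1 + t) * s) has_real_derivative
      (inner y (grad F y) + s)) (at 0)"
    by (auto intro!: derivative_eq_intros DERIV_along_line F_differentiable)
  moreover have "\<forall>t. \<bar>0 - t\<bar> < 1 \<longrightarrow>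
      F (y + 0 *\<^sub>R y) + (1 + 0) * s \<le> F (y + t *\<^sub>R y) + (1 + t) * s"
  proof (intro allI impI)
    fix t :: real assume "\<bar>0 - t\<bar> < 1"
    then show "F (y + 0 *\<^sub>R y) + (1 + 0) * s \<le> F (y + t *\<^sub>R y) + (1 + t) * s"
      using opt[of "1 + t"] by (simp add: scaleR_left_distrib)
  qed
  ultimately have "inner y (grad F y) + s = 0"
    by (rule DERIV_local_min[OF _ zero_less_one])
  then show ?thesis by simp
qed

lemma scaling_optimalE:
  assumes "scaling_optimal A u"
  obtains l where "\<And>w. w \<in> A \<Longrightarrow> 0 \<le> l w" "u = (\<Sum>w\<in>A. l w *\<^sub>R w)"
    "sum l A = - inner (K u) (grad F (K u))" "sum l A \<le> gap" "G u \<le> ennreal (sum l A)"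
proof -
  obtain l where A: "finite A" "A \<subseteq> Ext_ball G"
    and l: "\<And>w. w \<in> A \<Longrightarrow> 0 \<le> l w" "u = (\<Sum>w\<in>A. l w *\<^sub>R w)"
    and opt: "\<And>t. 0 \<le> t \<Longrightarrow> F (K u) + sum l A \<le> F (t *\<^sub>R K u) + t * sum l A"
    using assms unfolding scaling_optimal_def by blast
  have "sum l A = - inner (K u) (grad F (K u))"
    using opt by (rule weight_if_scaling_optimal)
  \<comment> \<open>The factor 0 compares with the zero coefficient vector.\<close>
  moreover have "sum l A \<le> gap" using opt[of 0] F_ge[of "K u"] by simp
  moreover have "G u \<le> ennreal (sum l A)"
    unfolding l(2) using A l(1) Ext_ball_le by (intro G_cone) auto
  ultimately show thesis using l by (intro that[of l]) auto
qed

lemma scaling_optimal_upper: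
  assumes "scaling_optimal A u"
  shows "G u \<le> ennreal gap" "F (K u) + enn2real (G u) \<le> upper_value u" "upper_value u \<le> F 0"
proof -
  from assms obtain l where l: "\<And>w. w \<in> A \<Longrightarrow> 0 \<le> l w"
    "sum l A = - inner (K u) (grad F (K u))" "sum l A \<le> gap" "G u \<le> ennreal (sum l A)"
    using scaling_optimalE[OF assms] by blast
  show "G u \<le> ennreal gap" using l(3,4) by (meson ennreal_leI order_trans)
  have "0 \<le> sum l A" using l(1) by (simp add: sum_nonneg)
  then have "enn2real (G u) \<le> sum l A" using l(4) by (metis enn2real_leI)
  then show "F (K u) + enn2real (G u) \<le> upper_value u" by (simp add: upper_value_def l(2))
  have "F (K u) + inner (0 - K u) (grad F (K u)) \<le> F 0"
    by (rule convex_gradient_inequality[OF F_convex F_differentiable])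
  then show "upper_value u \<le> F 0" by (simp add: upper_value_def)
qed

text \<open>The duality gap estimate: \<open>F\<close> is linearized at \<open>K u\<close>, and the
  oracle value times \<open>G w\<close> bounds the pairing of the dual variable with
  \<open>w\<close>.\<close>

lemma upper_value_lower_bound:
  assumes v: "fcgcg_oracle F K G u v" and w: "G w < \<infinity>"
  shows "upper_value u - (blinfun_apply v (dual_variable F K u) - 1) * enn2real (G w)
    \<le> F (K w) + enn2real (G w)"
proof -
  have "F (K u) + inner (K w - K u) (grad F (K u)) \<le> F (K w)"
    by (rule convex_gradient_inequality[OF F_convex F_differentiable])
  moreover have "- inner (K w) (grad F (K u)) \<le> blinfun_apply v (dual_variable F K u) * enn2real (G w)"
    using oracle_dual_bound[OF v, of w "enn2real (G w)"] w by (simp add: dual_pairing)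
  ultimately show ?thesis by (simp add: upper_value_def inner_diff_left algebra_simps)
qed

text \<open>Multiples \<open>t * l'\<close> of the optimal coefficients are feasible competitors in
  step (d), and deleting points with coefficient zero changes neither the iterate nor the total
  weight.\<close>

lemma correct_scaling_optimal:
  assumes A: "finite A" "A \<subseteq> Ext_ball G" and v: "v \<in> Ext_ball G"
    and cor: "fcgcg_correct F K A v A' u'"
  shows "scaling_optimal A' u'"
    and "\<And>l. (\<And>w. w \<in> insert v A \<Longrightarrow> 0 \<le> l w) \<Longrightarrow>
      upper_value u' \<le> F (K (\<Sum>w\<in>insert v A. l w *\<^sub>R w)) + sum l (insert v A)"
proof -
  obtain l' where l': "\<And>w. w \<in> insert v A \<Longrightarrow> 0 \<le> l' w"
    and min: "\<And>l. (\<And>w. w \<in> insert v A \<Longrightarrow> 0 \<le> l w) \<Longrightarrow>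
      F (\<Sum>w\<in>insert v A. l' w *\<^sub>R K w) + sum l' (insert v A)
        \<le> F (\<Sum>w\<in>insert v A. l w *\<^sub>R K w) + sum l (insert v A)"
    and u': "u' = (\<Sum>w\<in>insert v A. l' w *\<^sub>R w)" and A': "A' = insert v A - {w. l' w = 0}"
  proof -
    obtain l' where l': "is_arg_min
        (\<lambda>l. F (\<Sum>w\<in>insert v A. l w *\<^sub>R K w) + (\<Sum>w\<in>insert v A. l w))
        (\<lambda>l. \<forall>w\<in>insert v A. 0 \<le> l w) l'"
      "u' = (\<Sum>w\<in>insert v A. l' w *\<^sub>R w)" "A' = insert v A - {w. l' w = 0}"
      using cor unfolding fcgcg_correct_def by blast
    show ?thesis
      by (rule that[OF _ _ l'(2,3)]) (use l'(1) in \<open>auto simp: is_arg_min_def not_less\<close>)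
  qed
  have u'A': "u' = (\<Sum>w\<in>A'. l' w *\<^sub>R w)"
    unfolding u' A' using A by (intro sum.mono_neutral_right) auto
  have sA': "sum l' (insert v A) = sum l' A'"
    unfolding A' using A by (intro sum.mono_neutral_right) auto
  have Ku': "(\<Sum>w\<in>insert v A. l' w *\<^sub>R K w) = K u'" by (simp only: u' K_cone)
  have opt: "F (K u') + sum l' A' \<le> F (t *\<^sub>R K u') + t * sum l' A'" if "0 \<le> t" for t
  proof -
    have "F (K u') + sum l' A' \<le> F (\<Sum>w\<in>insert v A. (t * l' w) *\<^sub>R K w) + (\<Sum>w\<in>insert v A. t * l' w)"
      using min[of "\<lambda>w. t * l' w"] l' that by (simp only: Ku' sA') simp
    also have "(\<Sum>w\<in>insert v A. (t * l' w) *\<^sub>R K w) = t *\<^sub>R K u'"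
      by (simp only: Ku'[symmetric] scaleR_sum_right scaleR_scaleR)
    also have "(\<Sum>w\<in>insert v A. t * l' w) = t * sum l' A'"
      by (simp only: sA'[symmetric] sum_distrib_left)
    finally show ?thesis .
  qed
  show so: "scaling_optimal A' u'"
    unfolding scaling_optimal_def using A v l' u'A' opt A' by (intro conjI exI[of _ l']) auto
  fix l :: "('c \<Rightarrow>\<^sub>L real) \<Rightarrow> real" assume l: "\<And>w. w \<in> insert v A \<Longrightarrow> 0 \<le> l w"
  have "upper_value u' = F (K u') + sum l' A'"
    using weight_if_scaling_optimal[OF opt] by (simp add: upper_value_def)
  also have "\<dots> \<le> F (K (\<Sum>w\<in>insert v A. l w *\<^sub>R w)) + sum l (insert v A)"
    using min[OF l] by (simp only: Ku' sA' K_cone)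
  finally show "upper_value u' \<le> F (K (\<Sum>w\<in>insert v A. l w *\<^sub>R w)) + sum l (insert v A)" .
qed

text \<open>Weak* convergent subsequences become norm convergent under \<open>K\<close>. This
  provides the compact set for the Lipschitz hypothesis on the gradient.\<close>

lemma compact_K_sublevel:
  assumes "0 \<le> \<alpha>"
  shows "compact (K ` {u. G u \<le> ennreal \<alpha>})"
  unfolding compact_eq_seq_compact_metric
proof (rule seq_compactI)
  fix f :: "nat \<Rightarrow> 'y" assume "\<forall>n. f n \<in> K ` {u. G u \<le> ennreal \<alpha>}"
  then have "\<forall>n. \<exists>u. G u \<le> ennreal \<alpha> \<and> f n = K u" by auto
  then obtain s where s: "\<And>n. G (s n) \<le> ennreal \<alpha>" "\<And>n. f n = K (s n)" by metis
  obtain w r where w: "G w \<le> ennreal \<alpha>" and r: "strict_mono r"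
    and lim: "limitin weak_star (s \<circ> r) w sequentially"
    using weak_star_compact_imp_convergent_subsequence[OF separable sublevel_compact[OF assms], of s] s
    by auto
  have "(\<lambda>k. K ((s \<circ> r) k)) \<longlonglongrightarrow> K w"
    using G_finite[OF s(1)] by (intro K_strong lim) simp
  then have "(f \<circ> r) \<longlonglongrightarrow> K w" by (simp add: s(2) o_def)
  then show "\<exists>l\<in>K ` {u. G u \<le> ennreal \<alpha>}. \<exists>r. strict_mono r \<and> (f \<circ> r) \<longlonglongrightarrow> l"
    using w r by blast
qed

text \<open>The trial point \<open>(1 - t) u + t M v\<close> is feasible in step (d); here \<open>M = gap + 1\<close> bounds
  \<open>\<G>\<close> at all points with \<open>J \<le> J 0\<close>.\<close>

lemma descent_step:
  obtains C where "gap < C"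
    "\<And>A u v A' u' t. scaling_optimal A u \<Longrightarrow> fcgcg_oracle F K G u v \<Longrightarrow>
      fcgcg_correct F K A v A' u' \<Longrightarrow> 0 \<le> t \<Longrightarrow> t \<le> 1 \<Longrightarrow>
      upper_value u' \<le> upper_value u
        - t * ((gap + 1) * (blinfun_apply v (dual_variable F K u) - 1)) + C * t\<^sup>2"
proof -
  define M where "M = gap + 1"
  have M: "0 \<le> M" "gap \<le> M" using gap_nonneg by (auto simp: M_def)
  define S where "S = K ` {u. G u \<le> ennreal M}"
  have "compact S" unfolding S_def using M by (intro compact_K_sublevel)
  obtain L where L: "L-lipschitz_on S (grad F)" using grad_F_lipschitz[OF \<open>compact S\<close>] by auto
  have "bounded S" using \<open>compact S\<close> by (rule compact_imp_bounded)
  then obtain R where R: "\<And>y. y \<in> S \<Longrightarrow> norm y \<le> R" unfolding bounded_iff by auto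
  \<comment> \<open>The first term bounds the quadratic error since \<open>K x - K u\<close> has
    norm at most \<open>t * (2 * R)\<close>; adding \<open>M\<close> gives \<open>gap < C\<close>,
    needed to start the rate estimate.\<close>
  define C where "C = L * (2 * R)\<^sup>2 + M"
  have L0: "0 \<le> L" using L by (rule lipschitz_on_nonneg)
  show thesis
  proof (rule that[of C])
    show "gap < C" using L0 by (simp add: C_def M_def add_nonneg_pos)
  next
    fix A u v A' u' and t :: real
    assume so: "scaling_optimal A u" and ora: "fcgcg_oracle F K G u v"
      and cor: "fcgcg_correct F K A v A' u'" and t: "0 \<le> t" "t \<le> 1"
    have A: "finite A" "A \<subseteq> Ext_ball G" using so by (auto simp: scaling_optimal_def)
    have v: "v \<in> Ext_ball G" by (rule oracle_Ext[OF ora])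
    obtain l where l: "\<And>w. w \<in> A \<Longrightarrow> 0 \<le> l w" "u = (\<Sum>w\<in>A. l w *\<^sub>R w)"
      "sum l A = - inner (K u) (grad F (K u))"
      using scaling_optimalE[OF so] by blast
    define x where "x = (1 - t) *\<^sub>R u + t *\<^sub>R (M *\<^sub>R v)"
    \<comment> \<open>The two contributions are added because \<open>v\<close> may already belong to
      \<open>A\<close>.\<close>
    define a where "a w = (if w \<in> A then (1 - t) * l w else 0) + (if w = v then t * M else 0)" for w
    have a: "0 \<le> a w" for w using l(1) t M by (simp add: a_def)
    have eqA: "insert v A \<inter> {w. w \<in> A} = A" by auto
    have ax: "(\<Sum>w\<in>insert v A. a w *\<^sub>R w) = x"
    proof -
      have "(\<Sum>w\<in>insert v A. a w *\<^sub>R w) =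
          (\<Sum>w\<in>insert v A. if w \<in> A then ((1 - t) * l w) *\<^sub>R w else 0)
          + (\<Sum>w\<in>insert v A. if w = v then (t * M) *\<^sub>R w else 0)"
        unfolding sum.distrib[symmetric] by (intro sum.cong) (auto simp: a_def scaleR_left_distrib)
      also have "(\<Sum>w\<in>insert v A. if w = v then (t * M) *\<^sub>R w else 0) = t *\<^sub>R (M *\<^sub>R v)"
        using A by (subst sum.delta) auto
      also have "(\<Sum>w\<in>insert v A. if w \<in> A then ((1 - t) * l w) *\<^sub>R w else 0) = (1 - t) *\<^sub>R u"
        using A eqA by (simp only: sum.inter_restrict[symmetric] finite_insert Collect_mem_eq l(2) scaleR_sum_right scaleR_scaleR sum.If_cases)
      finally show ?thesis by (simp add: x_def)
    qed
    have sa: "sum a (insert v A) = (1 - t) * sum l A + t * M"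
    proof -
      have "sum a (insert v A) = (\<Sum>w\<in>insert v A. if w \<in> A then (1 - t) * l w else 0)
          + (\<Sum>w\<in>insert v A. if w = v then t * M else 0)"
        unfolding sum.distrib[symmetric] by (intro sum.cong) (auto simp: a_def)
      also have "(\<Sum>w\<in>insert v A. if w = v then t * M else 0) = t * M"
        using A by (subst sum.delta) auto
      also have "(\<Sum>w\<in>insert v A. if w \<in> A then (1 - t) * l w else 0) = (1 - t) * sum l A"
        using A eqA by (simp only: finite_insert sum.If_cases sum_distrib_left) simp
      finally show ?thesis .
    qed
    have Gu: "G u \<le> ennreal M"
      using scaling_optimal_upper(1)[OF so] M by (meson ennreal_leI order_trans)
    have GMv: "G (M *\<^sub>R v) \<le> ennreal M"
      using Ext_ball_le[OF v] M mult_left_mono[of "G v" 1 "ennreal M"] by (simp add: G_scaleR)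
    have "G x \<le> ennreal (1 - t) * G u + ennreal t * G (M *\<^sub>R v)"
      unfolding x_def using t by (intro G_convexD) auto
    also have "\<dots> \<le> ennreal (1 - t) * ennreal M + ennreal t * ennreal M"
      using Gu GMv by (intro add_mono mult_left_mono) auto
    also have "\<dots> = ennreal ((1 - t) * M + t * M)"
      using t M by (simp add: ennreal_mult ennreal_plus)
    finally have Gx: "G x \<le> ennreal M" by (simp add: algebra_simps)
    have KS: "K u \<in> S" "K (M *\<^sub>R v) \<in> S" "K x \<in> S" using Gu GMv Gx by (auto simp: S_def)
    have Kx: "K x - K u = t *\<^sub>R (K (M *\<^sub>R v) - K u)"
    proof -
      have "K x = (1 - t) *\<^sub>R K u + t *\<^sub>R K (M *\<^sub>R v)"
        unfolding x_def by (simp only: linear_add[OF K_linear] linear_cmul[OF K_linear])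
      then show ?thesis by (simp add: algebra_simps)
    qed
    have "norm (K (M *\<^sub>R v) - K u) \<le> 2 * R"
      using norm_triangle_ineq4[of "K (M *\<^sub>R v)" "K u"] R[OF KS(1)] R[OF KS(2)] by linarith
    then have "(norm (K x - K u))\<^sup>2 \<le> (t * (2 * R))\<^sup>2"
      unfolding Kx using t by (intro power_mono) (auto intro: mult_left_mono)
    then have "L * (norm (K x - K u))\<^sup>2 \<le> L * (t * (2 * R))\<^sup>2" using L0 by (rule mult_left_mono)
    moreover have "L * (t * (2 * R))\<^sup>2 \<le> C * t\<^sup>2"
      using M by (simp add: C_def power_mult_distrib algebra_simps)
    moreover have "F (K x) \<le> F (K u) + inner (K x - K u) (grad F (K u)) + L * (norm (K x - K u))\<^sup>2"
      by (rule lipschitz_gradient_descent[OF F_convex F_differentiable L KS(1,3)])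
    \<comment> \<open>Together with the change \<open>t * (M - sum l A)\<close> of the weight, the
      sum over \<open>A\<close> cancels and \<open>- t * M * (m - 1)\<close> remains,
      \<open>m\<close> being the oracle value.\<close>
    moreover have "inner (K x - K u) (grad F (K u))
        = t * (M * - blinfun_apply v (dual_variable F K u) + sum l A)"
      unfolding Kx using K_linear
      by (simp add: linear_cmul dual_pairing l(3) inner_diff_left algebra_simps)
    moreover have "upper_value u' \<le> F (K x) + sum a (insert v A)"
      using correct_scaling_optimal(2)[OF A v cor, of a] a by (simp only: ax)
    moreover have "upper_value u = F (K u) + sum l A" by (simp add: upper_value_def l(3))
    ultimately show "upper_value u' \<le> upper_value u
        - t * ((gap + 1) * (blinfun_apply v (dual_variable F K u) - 1)) + C * t\<^sup>2"
      unfolding sa M_def[symmetric] by (simp add: algebra_simps)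
  qed
qed

section \<open>Minimal values and minimizers of the objective\<close>

lemma objective_finite:
  assumes "G w < \<infinity>"
  shows "objective F K G w = ereal (F (K w) + enn2real (G w))"
proof -
  obtain g where g: "0 \<le> g" "G w = ennreal g" using assms by (cases "G w") auto
  then show ?thesis by (simp add: objective_def)
qed

lemma objective_infinite:
  assumes "\<not> G w < \<infinity>"
  shows "objective F K G w = \<infinity>"
proof -
  have "G w = \<infinity>" using assms less_top[of "G w"] by auto
  then show ?thesis by (simp add: objective_def)
qed

text \<open>Where \<open>G w\<close> exceeds \<open>gap\<close> the objective exceeds
  \<open>F 0\<close>, its value at 0; so a lower bound need only be tested where \<open>G\<close> is
  at most \<open>gap\<close>.\<close>

lemma le_objective:
  assumes "\<And>w. G w \<le> ennreal gap \<Longrightarrow> b \<le> F (K w) + enn2real (G w)"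
  shows "ereal b \<le> objective F K G w"
proof (cases "G w < \<infinity>")
  case False
  then show ?thesis by (simp add: objective_infinite)
next
  case fin: True
  have "b \<le> F (K w) + enn2real (G w)"
  proof (cases "G w \<le> ennreal gap")
    case True
    then show ?thesis by (rule assms)
  next
    case False
    obtain g where g: "0 \<le> g" "G w = ennreal g" using fin by (cases "G w") auto
    with False have "gap < g" using gap_nonneg by (simp add: not_le ennreal_less_iff)
    have "b \<le> F 0" using assms[of 0] linear_0[OF K_linear] by (simp add: G_zero)
    then show ?thesis using F_ge[of "K w"] \<open>gap < g\<close> g by simp
  qed
  then show ?thesis using fin by (simp add: objective_finite)
qed

text \<open>So far only an infimum, finite by the next lemma; along nonterminating runs attainment
  comes from accumulation points.\<close>

definition min_value :: real where
  "min_value = real_of_ereal (INF w. objective F K G w)"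

lemma INF_objective: "(INF w. objective F K G w) = ereal min_value"
proof -
  have "ereal (F 0 - gap) \<le> (INF w. objective F K G w)"
    by (intro INF_greatest le_objective) (use F_ge in \<open>auto intro: add_increasing2\<close>)
  moreover have "(INF w. objective F K G w) \<le> ereal (F 0)"
    using INF_lower[of 0 UNIV "objective F K G"] linear_0[OF K_linear]
    by (simp add: objective_finite G_zero)
  ultimately show ?thesis unfolding min_value_def
    by (cases "INF w. objective F K G w") auto
qed

lemma min_value_le: "G w < \<infinity> \<Longrightarrow> min_value \<le> F (K w) + enn2real (G w)"
  using INF_lower[of w UNIV "objective F K G"] by (simp add: INF_objective objective_finite)

lemma le_min_value:
  assumes "\<And>w. G w \<le> ennreal gap \<Longrightarrow> b \<le> F (K w) + enn2real (G w)"
  shows "b \<le> min_value"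
proof -
  have "ereal b \<le> (INF w. objective F K G w)" by (intro INF_greatest le_objective assms)
  then show ?thesis by (simp add: INF_objective)
qed

lemma minimizerI:
  assumes "G w < \<infinity>" "F (K w) + enn2real (G w) \<le> min_value"
  shows "minimizer (objective F K G) w"
  unfolding minimizer_def is_arg_min_def
proof (intro conjI notI)
  assume "\<exists>y. True \<and> objective F K G y < objective F K G w"
  then obtain y where y: "objective F K G y < ereal (F (K w) + enn2real (G w))"
    using assms(1) by (auto simp: objective_finite)
  have "ereal min_value \<le> objective F K G y"
    unfolding INF_objective[symmetric] by (rule INF_lower) simp
  also note y
  finally show False using assms(2) by simp
qed simp

text \<open>The duality gap estimate with \<open>G w\<close> replaced by its bound
  \<open>gap + 1\<close>, which the sign of the oracle value minus 1 permits.\<close>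

lemma upper_value_minus_min_value_le:
  assumes ora: "fcgcg_oracle F K G u v" and m: "1 \<le> blinfun_apply v (dual_variable F K u)"
  shows "upper_value u - min_value \<le> (gap + 1) * (blinfun_apply v (dual_variable F K u) - 1)"
proof -
  define m where "m = blinfun_apply v (dual_variable F K u)"
  have "upper_value u - (gap + 1) * (m - 1) \<le> min_value"
  proof (rule le_min_value)
    fix w assume w: "G w \<le> ennreal gap"
    have "enn2real (G w) \<le> gap" using w gap_nonneg by (simp add: enn2real_leI)
    then have "(m - 1) * enn2real (G w) \<le> (m - 1) * (gap + 1)"
      using m by (intro mult_left_mono) (auto simp: m_def)
    moreover have "G w < \<infinity>" using w by (rule G_finite)
    ultimately show "upper_value u - (gap + 1) * (m - 1) \<le> F (K w) + enn2real (G w)"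
      using upper_value_lower_bound[OF ora, of w] by (simp add: m_def[symmetric] mult.commute)
  qed
  then show ?thesis by (simp add: m_def)
qed

text \<open>Once the oracle value is at most 1, the duality gap estimate makes
  \<open>upper_value u\<close>, which dominates the objective at \<open>u\<close>, a lower bound for
  the objective everywhere.\<close>

lemma minimizer_if_stop:
  assumes so: "scaling_optimal A u" and ora: "fcgcg_oracle F K G u v"
    and m: "blinfun_apply v (dual_variable F K u) \<le> 1"
  shows "minimizer (objective F K G) u"
proof (rule minimizerI)
  show "G u < \<infinity>" using scaling_optimal_upper(1)[OF so] by (rule G_finite)
  have "upper_value u \<le> min_value"
  proof (rule le_min_value)
    fix w assume w: "G w \<le> ennreal gap"
    have "(blinfun_apply v (dual_variable F K u) - 1) * enn2real (G w) \<le> 0"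
      using m by (simp add: mult_nonpos_nonneg)
    moreover have "G w < \<infinity>" using w by (rule G_finite)
    ultimately show "upper_value u \<le> F (K w) + enn2real (G w)"
      using upper_value_lower_bound[OF ora, of w] by linarith
  qed
  then show "F (K u) + enn2real (G u) \<le> min_value"
    using scaling_optimal_upper(2)[OF so] by linarith
qed

text \<open>The smooth term converges because \<open>K\<close> maps the sequence to a norm
  convergent one, and \<open>G\<close> is handled by lower semicontinuity.\<close>

lemma limit_of_minimizing_sequence:
  assumes fin: "\<And>k. G (s k) < \<infinity>" and lim: "limitin weak_star s w sequentially"
    and e: "e \<longlonglongrightarrow> 0" and le: "\<And>k. F (K (s k)) + enn2real (G (s k)) \<le> min_value + e k"
  shows "minimizer (objective F K G) w"
proof -
  have "(\<lambda>k. K (s k)) \<longlonglongrightarrow> K w" by (rule K_strong[OF fin lim])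
  then have "(\<lambda>k. F (K (s k))) \<longlonglongrightarrow> F (K w)"
    using continuous_on_tendsto_compose[OF continuous_F[of UNIV]] by auto
  then have lim': "(\<lambda>k. min_value + e k - F (K (s k))) \<longlonglongrightarrow> min_value + 0 - F (K w)"
    by (intro tendsto_intros e)
  have nn: "0 \<le> min_value + e k - F (K (s k))" for k
    using le[of k] enn2real_nonneg[of "G (s k)"] by linarith
  \<comment> \<open>The sign matters because \<open>ennreal\<close> sends negative reals to
    0.\<close>
  have nonneg: "0 \<le> min_value - F (K w)"
    using LIMSEQ_le_const[OF lim', of 0] nn by auto
  have "G w \<le> ennreal (min_value - F (K w))"
  proof (rule ccontr)
    assume "\<not> ?thesis"
    then have "ennreal (min_value - F (K w)) < G w" by simp
    then obtain a' where a': "ennreal (min_value - F (K w)) < a'" "a' < G w"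
      using dense by blast
    then obtain a where a: "0 \<le> a" "a' = ennreal a" by (cases a') auto
    obtain U where U: "openin weak_star U" "w \<in> U" "\<And>v. v \<in> U \<Longrightarrow> a' < G v"
      using G_lsc[unfolded weak_star_lsc_def, rule_format, OF a'(2)] by auto
    have "\<forall>\<^sub>F k in sequentially. s k \<in> U" using lim U(1,2) by (auto simp: limitin_def)
    moreover have "min_value + 0 - F (K w) < a"
      using a' a nonneg by (simp add: ennreal_less_iff)
    then have "\<forall>\<^sub>F k in sequentially. min_value + e k - F (K (s k)) < a"
      using lim' by (rule order_tendstoD(2)[rotated])
    ultimately have "\<forall>\<^sub>F k in sequentially. False"
    proof eventually_elim
      case (elim k)
      have "G (s k) = ennreal (enn2real (G (s k)))" using fin[of k] by simp
      also have "\<dots> \<le> ennreal (min_value + e k - F (K (s k)))"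
        using le[of k] by (intro ennreal_leI) linarith
      also have "\<dots> \<le> ennreal a" using elim(2) by (intro ennreal_leI) simp
      finally show False using U(3)[OF elim(1)] a(2) by simp
    qed
    then show False by simp
  qed
  then show ?thesis
    using nonneg enn2real_leI[of "min_value - F (K w)" "G w"]
    by (intro minimizerI) (auto intro: G_finite[simplified])
qed

section \<open>Runs of the algorithm\<close>

lemma run_oracle:
  assumes "fcgcg_run F K G A u v" "\<And>j. j < k \<Longrightarrow> \<not> fcgcg_stop F K j (u j) (v j)"
  shows "fcgcg_oracle F K G (u k) (v k)"
  using assms unfolding fcgcg_run_def by simp

lemma run_correct:
  assumes "fcgcg_run F K G A u v" "\<And>j. j \<le> k \<Longrightarrow> \<not> fcgcg_stop F K j (u j) (v j)"
  shows "fcgcg_correct F K (A k) (v k) (A (Suc k)) (u (Suc k))"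
  using assms unfolding fcgcg_run_def by simp

lemma run_active_set:
  assumes run: "fcgcg_run F K G A u v" and ns: "\<And>j. j < k \<Longrightarrow> \<not> fcgcg_stop F K j (u j) (v j)"
  shows "finite (A k) \<and> A k \<subseteq> Ext_ball G"
  using ns
proof (induction k)
  case 0
  then show ?case using run by (simp add: fcgcg_run_def fcgcg_init_def)
next
  case (Suc k)
  then have A: "finite (A k)" "A k \<subseteq> Ext_ball G" by simp_all
  have "v k \<in> Ext_ball G" using Suc.prems by (intro oracle_Ext[OF run_oracle[OF run]]) simp
  moreover have "fcgcg_correct F K (A k) (v k) (A (Suc k)) (u (Suc k))"
    using Suc.prems by (intro run_correct[OF run]) simp
  ultimately show ?case
    using correct_scaling_optimal(1)[OF A] by (auto simp: scaling_optimal_def)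
qed

text \<open>Every iterate but the initial one comes out of step (d); hence the shifted
  index.\<close>

lemma run_scaling_optimal:
  assumes run: "fcgcg_run F K G A u v" and ns: "\<And>j. j \<le> k \<Longrightarrow> \<not> fcgcg_stop F K j (u j) (v j)"
  shows "scaling_optimal (A (Suc k)) (u (Suc k))"
proof -
  have A: "finite (A k)" "A k \<subseteq> Ext_ball G" using run_active_set[OF run, of k] ns by simp_all
  have "v k \<in> Ext_ball G" using ns by (intro oracle_Ext[OF run_oracle[OF run]]) simp
  then show ?thesis using correct_scaling_optimal(1)[OF A] run_correct[OF run] ns by blast
qed

lemma terminates_imp_minimizer:
  assumes run: "fcgcg_run F K G A u v" and "fcgcg_terminates_at F K u v n"
  shows "minimizer (objective F K G) (u n)"
proof -
  have ns: "\<And>j. j < n \<Longrightarrow> \<not> fcgcg_stop F K j (u j) (v j)" and "1 \<le> n"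
    and stop: "blinfun_apply (v n) (dual_variable F K (u n)) \<le> 1"
    using assms(2) by (auto simp: fcgcg_terminates_at_def fcgcg_stop_def)
  \<comment> \<open>The stopping test demands \<open>1 \<le> n\<close>, so the output was produced
    by step (d).\<close>
  then obtain k where k: "n = Suc k" by (cases n) auto
  have "scaling_optimal (A n) (u n)"
    unfolding k using ns k by (intro run_scaling_optimal[OF run]) simp
  then show ?thesis using run_oracle[OF run ns] stop by (rule minimizer_if_stop)
qed

text \<open>The least stopping index would be a termination index.\<close>

lemma nonterminating_no_stop:
  assumes "\<And>n. \<not> fcgcg_terminates_at F K u v n"
  shows "\<not> fcgcg_stop F K k (u k) (v k)"
proof (induction k rule: less_induct)
  case (less k)
  then show ?case using assms[of k] by (auto simp: fcgcg_terminates_at_def)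
qed

lemma run_rate:
  assumes run: "fcgcg_run F K G A u v" and ns: "\<And>k. \<not> fcgcg_stop F K k (u k) (v k)"
  obtains c where "0 < c" "\<And>k. G (u k) < \<infinity>"
    "\<And>k. F (K (u k)) + enn2real (G (u k)) \<le> min_value + c / (real k + 1)"
proof -
  obtain C where gapC: "gap < C" and descent:
    "\<And>A u v A' u' t. scaling_optimal A u \<Longrightarrow> fcgcg_oracle F K G u v \<Longrightarrow>
      fcgcg_correct F K A v A' u' \<Longrightarrow> 0 \<le> t \<Longrightarrow> t \<le> 1 \<Longrightarrow>
      upper_value u' \<le> upper_value u
        - t * ((gap + 1) * (blinfun_apply v (dual_variable F K u) - 1)) + C * t\<^sup>2"
    using descent_step by blast
  have C: "0 < C" using gapC gap_nonneg by simp
  have so: "scaling_optimal (A k) (u k)" if "1 \<le> k" for k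
    using that run_scaling_optimal[OF run, of "k - 1"] ns by simp
  define r where "r k = upper_value (u k) - min_value" for k
  have Gfin: "G (u k) < \<infinity>" for k
  proof (cases "k = 0")
    case True
    obtain l where l: "\<forall>w\<in>A 0. 0 < l w" "u 0 = (\<Sum>w\<in>A 0. l w *\<^sub>R w)"
      using run by (auto simp: fcgcg_run_def fcgcg_init_def)
    have "G (u 0) \<le> ennreal (sum l (A 0))"
      unfolding l(2) using run_active_set[OF run, of 0] l(1) Ext_ball_le
      by (intro G_cone) (auto intro: less_imp_le)
    then show ?thesis using True G_finite by blast
  next
    case False
    then have "1 \<le> k" by simp
    from scaling_optimal_upper(1)[OF so[OF this]] show ?thesis by (rule G_finite)
  qed
  have le_r: "F (K (u k)) + enn2real (G (u k)) \<le> min_value + r k" if "1 \<le> k" for k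
    using scaling_optimal_upper(2)[OF so[OF that]] by (simp add: r_def)
  have rate: "r k \<le> 4 * C / (real k + 1)" if "1 \<le> k" for k
  proof (rule descent_imp_harmonic_rate[OF C _ _ _ that])
    show "0 \<le> r k" if "1 \<le> k" for k
      using le_r[OF that] min_value_le[OF Gfin, of k] by simp
    \<comment> \<open>With \<open>upper_value (u 1) \<le> F 0\<close> this gives
      \<open>r 1 \<le> gap < C\<close>.\<close>
    have "F 0 - gap \<le> min_value"
      by (intro le_min_value) (use F_ge in \<open>auto intro: add_increasing2\<close>)
    then show "r 1 \<le> 2 * C"
      using scaling_optimal_upper(3)[OF so[of 1]] gapC C by (simp add: r_def)
    show "r (Suc k) \<le> r k - t * r k + C * t\<^sup>2" if "1 \<le> k" "0 \<le> t" "t \<le> 1" for k t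
    proof -
      have ora: "fcgcg_oracle F K G (u k) (v k)" using ns by (intro run_oracle[OF run])
      have "upper_value (u (Suc k)) \<le> upper_value (u k)
          - t * ((gap + 1) * (blinfun_apply (v k) (dual_variable F K (u k)) - 1)) + C * t\<^sup>2"
        using descent[OF so[OF that(1)] ora run_correct[OF run] that(2,3)] ns by blast
      \<comment> \<open>For \<open>k \<ge> 1\<close> the stopping test can fail only through the
        oracle value, so the duality gap estimate applies.\<close>
      moreover have "1 \<le> blinfun_apply (v k) (dual_variable F K (u k))"
        using ns[of k] that(1) by (simp add: fcgcg_stop_def)
      then have "t * r k \<le> t * ((gap + 1) * (blinfun_apply (v k) (dual_variable F K (u k)) - 1))"
        using upper_value_minus_min_value_le[OF ora] that(2) by (intro mult_left_mono) (auto simp: r_def)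
      ultimately show ?thesis by (simp add: r_def)
    qed
  qed
  \<comment> \<open>The maximum absorbs the error at \<open>k = 0\<close>, which the recursion does
    not reach.\<close>
  define c where "c = max (4 * C) (F (K (u 0)) + enn2real (G (u 0)) - min_value)"
  show thesis
  proof (rule that[of c])
    show "0 < c" using C by (simp add: c_def)
    show "F (K (u k)) + enn2real (G (u k)) \<le> min_value + c / (real k + 1)" for k
    proof (cases "k = 0")
      case True
      then show ?thesis by (simp add: c_def)
    next
      case False
      then have "r k \<le> 4 * C / (real k + 1)" "1 \<le> k" by (auto intro: rate)
      moreover have "4 * C / (real k + 1) \<le> c / (real k + 1)"
        by (intro divide_right_mono) (auto simp: c_def)
      ultimately show ?thesis using le_r[of k] by linarith
    qed
  qed (rule Gfin)
qed

lemma bounded_convergent_subsequence: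
  assumes "\<And>k. G (s k) \<le> ennreal a" "0 \<le> a"
  obtains w where "weak_star_accumulation s w"
  using weak_star_compact_imp_convergent_subsequence[OF separable sublevel_compact[OF assms(2)], of s]
    assms(1) unfolding weak_star_accumulation_def by blast

lemma run_nonterminating:
  assumes run: "fcgcg_run F K G A u v" and nt: "\<And>n. \<not> fcgcg_terminates_at F K u v n"
  shows "\<exists>c::real. c > 0 \<and> (\<forall>k. objective F K G (u k) - (INF w. objective F K G w)
           \<le> ereal (c / (real k + 1)))"
    and "\<exists>w. weak_star_accumulation u w"
    and "weak_star_accumulation u w \<Longrightarrow> minimizer (objective F K G) w"
    and "minimizer (objective F K G) w \<Longrightarrow> (\<And>w'. minimizer (objective F K G) w' \<Longrightarrow> w' = w) \<Longrightarrow>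
           limitin weak_star u w sequentially"
proof -
  have ns: "\<not> fcgcg_stop F K k (u k) (v k)" for k by (rule nonterminating_no_stop[OF nt])
  obtain c where c: "0 < c" and Gfin: "\<And>k. G (u k) < \<infinity>"
    and rate: "\<And>k. F (K (u k)) + enn2real (G (u k)) \<le> min_value + c / (real k + 1)"
    using run_rate[OF run ns] by blast
  show "\<exists>c::real. c > 0 \<and> (\<forall>k. objective F K G (u k) - (INF w. objective F K G w)
           \<le> ereal (c / (real k + 1)))"
  proof (intro exI[of _ c] conjI allI c)
    fix k
    show "objective F K G (u k) - (INF w. objective F K G w) \<le> ereal (c / (real k + 1))"
      using rate[of k] by (simp add: objective_finite[OF Gfin] INF_objective)
  qed
  have acc_min: "minimizer (objective F K G) w" if "weak_star_accumulation u w" for w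
  proof -
    obtain q where q: "strict_mono q" "limitin weak_star (u \<circ> q) w sequentially"
      using \<open>weak_star_accumulation u w\<close> by (auto simp: weak_star_accumulation_def)
    have "(\<lambda>k. c / (real k + 1)) \<longlonglongrightarrow> 0"
      using tendsto_mult[OF tendsto_const LIMSEQ_inverse_real_of_nat, of c]
      by (simp add: divide_inverse add.commute)
    then have "((\<lambda>k. c / (real k + 1)) \<circ> q) \<longlonglongrightarrow> 0" using q(1) by (rule LIMSEQ_subseq_LIMSEQ)
    with q(2) show ?thesis
      by (rule limit_of_minimizing_sequence[rotated]) (simp_all add: rate Gfin[simplified])
  qed
  then show "weak_star_accumulation u w \<Longrightarrow> minimizer (objective F K G) w" .
  \<comment> \<open>The bound \<open>gap\<close> holds from index 1 on; the maximum includes the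
    initial iterate.\<close>
  define a where "a = max gap (enn2real (G (u 0)))"
  have a: "0 \<le> a" using gap_nonneg by (simp add: a_def)
  have Ga: "G (u k) \<le> ennreal a" for k
  proof (cases k)
    case 0
    have "G (u 0) = ennreal (enn2real (G (u 0)))" using Gfin[of 0] by simp
    also have "\<dots> \<le> ennreal a" by (intro ennreal_leI) (simp add: a_def)
    finally show ?thesis by (simp add: 0)
  next
    case (Suc j)
    have "G (u k) \<le> ennreal gap"
      unfolding Suc by (rule scaling_optimal_upper(1)[OF run_scaling_optimal[OF run ns]])
    also have "\<dots> \<le> ennreal a" by (intro ennreal_leI) (simp add: a_def)
    finally show ?thesis .
  qed
  obtain w0 where "weak_star_accumulation u w0" by (rule bounded_convergent_subsequence[OF Ga a])
  then show "\<exists>w. weak_star_accumulation u w" ..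
  show "limitin weak_star u w sequentially"
    if uniq: "\<And>w'. minimizer (objective F K G) w' \<Longrightarrow> w' = w"
  \<comment> \<open>Without convergence a subsequence stays outside a neighbourhood of
    \<open>w\<close>, but its own accumulation point is one of \<open>u\<close>, hence a minimizer,
    hence \<open>w\<close>.\<close>
  proof (rule ccontr)
    assume "\<not> limitin weak_star u w sequentially"
    then obtain U where U: "openin weak_star U" "w \<in> U" "\<not> (\<forall>\<^sub>F k in sequentially. u k \<in> U)"
      by (auto simp: limitin_def strong_operator_topology_topspace)
    then have "infinite {k. u k \<notin> U}"
      by (simp add: eventually_cofinite cofinite_eq_sequentially[symmetric])
    then obtain q :: "nat \<Rightarrow> nat" where q: "strict_mono q" "\<And>k. u (q k) \<notin> U"
      using infinite_enumerate[of "{k. u k \<notin> U}"] by auto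
    have "G ((u \<circ> q) k) \<le> ennreal a" for k using Ga by simp
    then obtain w' where "weak_star_accumulation (u \<circ> q) w'"
      using a by (rule bounded_convergent_subsequence)
    then obtain p where p: "strict_mono p" "limitin weak_star (u \<circ> q \<circ> p) w' sequentially"
      by (auto simp: weak_star_accumulation_def)
    then have "weak_star_accumulation u w'"
      unfolding weak_star_accumulation_def using strict_mono_o[OF q(1) p(1)]
      by (intro exI[of _ "q \<circ> p"]) (simp add: comp_assoc)
    then have "w' = w" using uniq acc_min by blast
    then have "\<forall>\<^sub>F k in sequentially. (u \<circ> q \<circ> p) k \<in> U"
      using p(2) U(1,2) by (simp add: limitin_def)
    then show False using q(2) by simp
  qed
qed

end

theorem theorem3p3:
  fixes F :: "'y::{real_inner, complete_space} \<Rightarrow> real"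
    and K :: "('c::banach \<Rightarrow>\<^sub>L real) \<Rightarrow> 'y"
    and G :: "('c \<Rightarrow>\<^sub>L real) \<Rightarrow> ennreal"
  assumes separable: "separable_space (euclidean :: 'c topology)"
    and F_convex: "convex_on UNIV F"
    and K_linear: "linear K"
    and K_continuous: "continuous_map weak_star weak_topology K"
    and G_convex: "convex_ennreal G"
    and G_lsc: "weak_star_lsc G"
    and G_homogeneous: "pos_homogeneous G"
    and F_bounded_below: "bdd_below (range F)"
    and F_strictly_convex: "strictly_convex F"
    and F_differentiable: "\<And>y. F differentiable (at y)"
    and grad_F_lipschitz: "\<And>S. compact S \<Longrightarrow> \<exists>L. L-lipschitz_on S (grad F)"
    and sublevel_compact: "\<And>\<alpha>::real. 0 \<le> \<alpha> \<Longrightarrow> compactin weak_star {u. G u \<le> ennreal \<alpha>}"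
    and K_strong: "\<And>s w. (\<And>k::nat. G (s k) < \<infinity>) \<Longrightarrow> limitin weak_star s w sequentially
                     \<Longrightarrow> (\<lambda>k. K (s k)) \<longlonglongrightarrow> K w"
  shows "(\<forall>w. \<exists>z. fcgcg_oracle F K G w z) \<and>
         (\<forall>S z. finite S \<longrightarrow> (\<exists>S' w. fcgcg_correct F K S z S' w)) \<and>
         (\<forall>A u v. fcgcg_run F K G A u v \<longrightarrow>
            (\<exists>n. fcgcg_terminates_at F K u v n \<and> minimizer (objective F K G) (u n)) \<or>
            ((\<forall>n. \<not> fcgcg_terminates_at F K u v n) \<and>
             (\<exists>w. minimizer (objective F K G) w) \<and>
             (\<exists>c::real. c > 0 \<and>
                (\<forall>k. objective F K G (u k) - (INF w. objective F K G w)
                       \<le> ereal (c / (real k + 1)))) \<and>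
             (\<exists>w. weak_star_accumulation u w) \<and>
             (\<forall>w. weak_star_accumulation u w \<longrightarrow> minimizer (objective F K G) w) \<and>
             (\<forall>w. minimizer (objective F K G) w \<and>
                  (\<forall>w'. minimizer (objective F K G) w' \<longrightarrow> w' = w) \<longrightarrow>
                  limitin weak_star u w sequentially)))"
proof -
  interpret fcgcg_setting F K G
    by (rule fcgcg_setting.intro) (fact assms)+
  show ?thesis
  proof (intro conjI allI impI)
    show "\<exists>z. fcgcg_oracle F K G w z" for w by (rule oracle_exists)
    show "\<exists>S' w. fcgcg_correct F K S z S' w" if "finite S" for S z
      using that by (rule correct_exists)
    fix A u v assume run: "fcgcg_run F K G A u v"
    show "(\<exists>n. fcgcg_terminates_at F K u v n \<and> minimizer (objective F K G) (u n)) \<or>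
            ((\<forall>n. \<not> fcgcg_terminates_at F K u v n) \<and>
             (\<exists>w. minimizer (objective F K G) w) \<and>
             (\<exists>c::real. c > 0 \<and>
                (\<forall>k. objective F K G (u k) - (INF w. objective F K G w)
                       \<le> ereal (c / (real k + 1)))) \<and>
             (\<exists>w. weak_star_accumulation u w) \<and>
             (\<forall>w. weak_star_accumulation u w \<longrightarrow> minimizer (objective F K G) w) \<and>
             (\<forall>w. minimizer (objective F K G) w \<and>
                  (\<forall>w'. minimizer (objective F K G) w' \<longrightarrow> w' = w) \<longrightarrow>
                  limitin weak_star u w sequentially))"
    proof (cases "\<exists>n. fcgcg_terminates_at F K u v n")
      case True
      then show ?thesis using terminates_imp_minimizer[OF run] by blast
    next
      case False
      then have nt: "\<not> fcgcg_terminates_at F K u v n" for n by blast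
      note R = run_nonterminating[OF run nt]
      show ?thesis
      proof (intro disjI2 conjI allI impI)
        \<comment> \<open>An accumulation point exists and is a minimizer, so the infimum is
          attained.\<close>
        show "\<exists>w. minimizer (objective F K G) w" using R(2,3) by blast
        show "limitin weak_star u w sequentially"
          if "minimizer (objective F K G) w \<and> (\<forall>w'. minimizer (objective F K G) w' \<longrightarrow> w' = w)" for w
          using that by (intro R(4)) auto
      qed (fact nt R(1,2,3))+
    qed
  qed
qed

end
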